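(* If $H$ is a $k$-shifted clique, then the problem $\textsc{Hom}_<^\star$ can be solved in time $n^{\mathcal{O}(k)}\cdot h^{\mathcal{O}(1)}$, where $n=|V(G)|$ and $h=|V(H)|$.
   Context: An ordered graph is a (simple) graph whose vertex set is equipped with a total order $\le$. For ordered graphs $G,H$, an ordered homomorphism from $G$ to $H$ is a map $f:V(G)\to V(H)$ such that (1) $uv\in E(G)$ implies $f(u)f(v)\in E(H)$, and (2) $u\le v$ implies $f(u)\le f(v)$. A segment of an ordered graph is a set of vertices that are consecutive in the order. An ordered graph $H$ is a $k$-shifted clique if $V(H)$ can be partitioned into segments $V_1,\dots,V_k$ with $V_i<V_{i+1}$ (every vertex of $V_i$ precedes every vertex of $V_{i+1}$) for $i\in[k-1]$, each inducing a clique in $H$, and such that for every $i>1$ and all $u,u'\in V_i$ with $u<u'$ we have $N(u')\cap\bigcup_{j<i}V_j\subseteq N(u)\cap\bigcup_{j<i}V_j$. The vertices of $H$ are identified with $1,\dots,h$ according to their order. The problem $\textsc{Hom}_<^\star$: given an ordered graph $H$ that is a $k$-shifted clique and an ordered graph $G$ with functions $\mathsf{low},\mathsf{up}:V(G)\to[h]$, decide whether there exists an ordered homomorphism $f:G\to H$ with $\mathsf{low}(v)\le f(v)\le\mathsf{up}(v)$ for every $v\in V(G)$. *)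

theory Defs
  imports Main
begin

text \<open>An ordered graph on n vertices is represented with vertex set {1..n}, ordered by the
natural order on nat, and a symmetric irreflexive edge predicate E (only its values on
{1..n} matter).\<close>

definition ordered_graph :: "nat \<Rightarrow> (nat \<Rightarrow> nat \<Rightarrow> bool) \<Rightarrow> bool" where
  "ordered_graph n E \<longleftrightarrow>
     (\<forall>u\<in>{1..n}. \<forall>v\<in>{1..n}. E u v \<longrightarrow> E v u) \<and> (\<forall>u\<in>{1..n}. \<not> E u u)"

text \<open>k-shifted clique: segments V_i = {b (i-1) ..< b i}, i = 1..k, partitioning {1..h}.\<close>

definition shifted_clique :: "nat \<Rightarrow> (nat \<Rightarrow> nat \<Rightarrow> bool) \<Rightarrow> nat \<Rightarrow> bool" where
  "shifted_clique h E k \<longleftrightarrow>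
     (\<exists>b :: nat \<Rightarrow> nat.
        b 0 = 1 \<and> b k = h + 1 \<and>
        (\<forall>i\<in>{1..k}. b (i - 1) < b i) \<and>
        (\<forall>i\<in>{1..k}. \<forall>u\<in>{b (i - 1)..<b i}. \<forall>v\<in>{b (i - 1)..<b i}. u \<noteq> v \<longrightarrow> E u v) \<and>
        (\<forall>i\<in>{2..k}. \<forall>u\<in>{b (i - 1)..<b i}. \<forall>u'\<in>{b (i - 1)..<b i}. u < u' \<longrightarrow>
            (\<forall>w\<in>{1..<b (i - 1)}. E u' w \<longrightarrow> E u w)))"

definition ordered_hom ::
  "nat \<Rightarrow> (nat \<Rightarrow> nat \<Rightarrow> bool) \<Rightarrow> nat \<Rightarrow> (nat \<Rightarrow> nat \<Rightarrow> bool) \<Rightarrow> (nat \<Rightarrow> nat) \<Rightarrow> bool" where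
  "ordered_hom n EG h EH f \<longleftrightarrow>
     (\<forall>v\<in>{1..n}. f v \<in> {1..h}) \<and>
     (\<forall>u\<in>{1..n}. \<forall>v\<in>{1..n}. EG u v \<longrightarrow> EH (f u) (f v)) \<and>
     (\<forall>u\<in>{1..n}. \<forall>v\<in>{1..n}. u \<le> v \<longrightarrow> f u \<le> f v)"

definition hom_star_yes ::
  "nat \<Rightarrow> (nat \<Rightarrow> nat \<Rightarrow> bool) \<Rightarrow> nat \<Rightarrow> (nat \<Rightarrow> nat \<Rightarrow> bool) \<Rightarrow> (nat \<Rightarrow> nat) \<Rightarrow> (nat \<Rightarrow> nat) \<Rightarrow> bool" where
  "hom_star_yes h EH n EG low up \<longleftrightarrow>
     (\<exists>f. ordered_hom n EG h EH f \<and> (\<forall>v\<in>{1..n}. low v \<le> f v \<and> f v \<le> up v))"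

datatype instr =
    LoadC nat nat
  | Add nat nat nat
  | Sub nat nat nat
  | Load nat nat
  | Store nat nat
  | Jz nat nat
  | Halt

type_synonym config = "nat \<times> (nat \<Rightarrow> nat)"

definition halted :: "instr list \<Rightarrow> config \<Rightarrow> bool" where
  "halted P s \<longleftrightarrow> fst s \<ge> length P \<or> P ! fst s = Halt"

definition step :: "instr list \<Rightarrow> config \<Rightarrow> config" where
  "step P s = (if halted P s then s else
     (let pc = fst s; m = snd s in
      case P ! pc of
        LoadC r c \<Rightarrow> (pc + 1, m(r := c))
      | Add r a b \<Rightarrow> (pc + 1, m(r := m a + m b))
      | Sub r a b \<Rightarrow> (pc + 1, m(r := m a - m b))
      | Load r a \<Rightarrow> (pc + 1, m(r := m (m a)))
      | Store a b \<Rightarrow> (pc + 1, m(m a := m b))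
      | Jz a l \<Rightarrow> (if m a = 0 then (l, m) else (pc + 1, m))
      | Halt \<Rightarrow> s))"

definition run :: "instr list \<Rightarrow> nat \<Rightarrow> config \<Rightarrow> config" where
  "run P t s = (step P ^^ t) s"

definition init :: "nat list \<Rightarrow> config" where
  "init xs = (0, \<lambda>i. if i < length xs then xs ! i else 0)"

definition encode ::
  "nat \<Rightarrow> (nat \<Rightarrow> nat \<Rightarrow> bool) \<Rightarrow> nat \<Rightarrow> (nat \<Rightarrow> nat \<Rightarrow> bool) \<Rightarrow> (nat \<Rightarrow> nat) \<Rightarrow> (nat \<Rightarrow> nat) \<Rightarrow> nat list" where
  "encode h EH n EG low up =
     [h, n]
     @ concat (map (\<lambda>u. map (\<lambda>v. if EH u v then 1 else 0) [1..<h+1]) [1..<h+1])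
     @ concat (map (\<lambda>u. map (\<lambda>v. if EG u v then 1 else 0) [1..<n+1]) [1..<n+1])
     @ map low [1..<n+1]
     @ map up [1..<n+1]"

end

theory Submission
  imports Defs
begin

text \<open>The segments of \<open>H\<close> are found greedily; this never yields more of them than a given
  \<open>k\<close>-shifted clique partition. Then all cut vectors \<open>d\<close> are enumerated, where \<open>d s\<close> is the last vertex
  of \<open>G\<close> that is mapped to a segment before the \<open>s\<close>-th one; there are at most \<open>(n + 1) ^ k\<close> of them.
  For a fixed cut vector the solution is pushed up from \<open>f = low\<close>: a violated pair forces either
  \<open>f u\<close> or \<open>f v\<close> to increase, because lowering the image of \<open>v\<close> inside its segment only enlarges
  its neighbourhood in earlier segments. Hence \<open>f\<close> stays below every solution with these cuts, and
  after at most \<open>n * h\<close> increments it is a solution or none exists.\<close>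

section \<open>A structured language for the machine\<close>

text \<open>A cut vector is fixed because a missing edge below \<open>v\<close> could otherwise be
  repaired in two ways: by raising the image of \<open>u\<close>, or by moving the image of
  \<open>v\<close> to a later segment, whose neighbourhoods are unrelated. Once the segment of every
  image is prescribed, only the first repair remains, so every violation has one forced response and
  the candidate never has to branch.

  A single program must serve all \<open>k\<close>, and it is given neither \<open>k\<close> nor a
  partition. The exponent therefore has to come from a number that the machine computes itself, the
  greedy segment count. All remaining factors must be polynomial with an absolute exponent; to get
  this, the innermost loops have loop-free bodies of constant cost and only their rounds are
  counted.

  The machine offers addition, truncated subtraction and a conditional jump, and the input fills the
  cells from 0 on, so no register is free at the start. Register 2 is taken as scratch for jumps
  because its initial content is always 0. Moving the input above 64 reserved registers then gives
  ordinary variables and arrays.\<close>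

type_synonym mem = "nat \<Rightarrow> nat"

definition basic :: "instr \<Rightarrow> bool" where
  "basic i \<longleftrightarrow> i \<noteq> Halt \<and> (\<forall>a l. i \<noteq> Jz a l)"

definition eff :: "instr \<Rightarrow> mem \<Rightarrow> mem" where
  "eff i m = snd (step [i] (0, m))"

lemma basic_simps [simp]:
  "basic (LoadC r c)" "basic (Add r a b)" "basic (Sub r a b)" "basic (Load r a)" "basic (Store a b)"
  by (auto simp: basic_def)

lemma eff_simps [simp]:
  "eff (LoadC r c) m = m(r := c)"
  "eff (Add r a b) m = m(r := m a + m b)"
  "eff (Sub r a b) m = m(r := m a - m b)"
  "eff (Load r a) m = m(r := m (m a))"
  "eff (Store a b) m = m(m a := m b)"
  by (auto simp: eff_def step_def halted_def)

section \<open>Structured control flow compiled to conditional jumps, with time bounds\<close>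

datatype lcom =
    Block "instr list"
  | LSeq lcom lcom
  | LIf nat lcom lcom
  | LWhile nat lcom

text \<open>The 3 counts the test \<open>Jz\<close> and the two instructions of an emulated jump.
  Lengths do not depend on the load position, so jump targets can be computed in advance.\<close>

fun clen :: "lcom \<Rightarrow> nat" where
  "clen (Block cs) = length cs"
| "clen (LSeq c1 c2) = clen c1 + clen c2"
| "clen (LIf r c1 c2) = clen c1 + clen c2 + 3"
| "clen (LWhile r c) = clen c + 3"

text \<open>The machine has no unconditional jump; it is emulated by clearing register 2 and testing it.\<close>

fun comp :: "nat \<Rightarrow> lcom \<Rightarrow> instr list" where
  "comp p (Block cs) = cs"
| "comp p (LSeq c1 c2) = comp p c1 @ comp (p + clen c1) c2"
| "comp p (LIf r c1 c2) =
     [Jz r (p + clen c1 + 3)] @ comp (p + 1) c1 @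
     [LoadC 2 0, Jz 2 (p + clen c1 + clen c2 + 3)] @ comp (p + clen c1 + 3) c2"
| "comp p (LWhile r c) =
     [Jz r (p + clen c + 3)] @ comp (p + 1) c @ [LoadC 2 0, Jz 2 p]"

lemma length_comp [simp]: "length (comp p c) = clen c"
  by (induction c arbitrary: p) auto

text \<open>Quantifying over all \<open>pre\<close> and \<open>post\<close> makes the judgement
  position-independent, as needed for code nested in longer code. \<open>T\<close> is only an upper
  bound, so branches of different lengths can share it.\<close>

definition exec :: "lcom \<Rightarrow> mem \<Rightarrow> mem \<Rightarrow> nat \<Rightarrow> bool" where
  "exec c m m' T \<longleftrightarrow> (\<forall>pre post. \<exists>t\<le>T.
     run (pre @ comp (length pre) c @ post) t (length pre, m) = (length pre + clen c, m'))"

lemma run_add: "run P t1 s = s1 \<Longrightarrow> run P t2 s1 = s2 \<Longrightarrow> run P (t1 + t2) s = s2"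
  by (simp add: run_def funpow_add add.commute[of t1])

lemma run_Suc: "run P (Suc t) s = run P t (step P s)"
  by (simp add: run_def funpow_swap1)

lemma run_0 [simp]: "run P 0 s = s"
  by (simp add: run_def)

lemma run_trans:
  "\<exists>t\<le>T1. run P t s = s1 \<Longrightarrow> \<exists>t\<le>T2. run P t s1 = s2 \<Longrightarrow> \<exists>t\<le>T1 + T2. run P t s = s2"
  by (meson add_mono run_add)

lemma run_step: "step P s = s1 \<Longrightarrow> \<exists>t\<le>Suc 0. run P t s = s1"
  by (rule exI[of _ "Suc 0"]) (simp add: run_Suc)

lemma execD:
  assumes "exec c m m' T" and "P = pre @ comp p c @ post" and "p = length pre"
  shows "\<exists>t\<le>T. run P t (p, m) = (p + clen c, m')"
  using assms by (auto simp: exec_def)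

lemma exec_mono: "exec c m m' T \<Longrightarrow> T \<le> T' \<Longrightarrow> exec c m m' T'"
  unfolding exec_def by (meson le_trans)

lemma step_basic:
  assumes "basic i" and "P = pre @ [i] @ post" and "p = length pre"
  shows "step P (p, m) = (p + 1, eff i m)"
  using assms by (cases i) (auto simp: step_def halted_def basic_def nth_append)

lemma step_Jz:
  assumes "P = pre @ [Jz r l] @ post" and "p = length pre"
  shows "step P (p, m) = (if m r = 0 then l else p + 1, m)"
  using assms by (auto simp: step_def halted_def nth_append)

lemma run_block:
  assumes "\<forall>i\<in>set cs. basic i"
  shows "run (pre @ cs @ post) (length cs) (length pre, m) = (length pre + length cs, fold eff cs m)"
  using assms
proof (induction cs arbitrary: pre m)
  case Nil
  then show ?case by simp
next
  case (Cons i cs)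
  have "step (pre @ (i # cs) @ post) (length pre, m) = (length pre + 1, eff i m)"
    by (rule step_basic[where post = "cs @ post"]) (use Cons.prems in auto)
  moreover have "run ((pre @ [i]) @ cs @ post) (length cs) (length (pre @ [i]), eff i m)
      = (length (pre @ [i]) + length cs, fold eff cs (eff i m))"
    by (rule Cons.IH) (use Cons.prems in auto)
  ultimately show ?case by (simp add: run_Suc)
qed

lemma exec_Block: "\<forall>i\<in>set cs. basic i \<Longrightarrow> exec (Block cs) m (fold eff cs m) (length cs)"
  unfolding exec_def by (metis clen.simps(1) comp.simps(1) le_refl run_block)

lemma exec_Seq:
  assumes "exec c1 m m1 T1" and "exec c2 m1 m2 T2"
  shows "exec (LSeq c1 c2) m m2 (T1 + T2)"
  unfolding exec_def
proof (intro allI)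
  fix pre post
  let ?P = "pre @ comp (length pre) (LSeq c1 c2) @ post" and ?p = "length pre"
  have f0: "\<exists>t\<le>T1. run ?P t (?p, m) = (?p + clen c1, m1)"
    by (rule execD[OF assms(1)]) auto
  have f1: "\<exists>t\<le>T2. run ?P t (?p + clen c1, m1) = (?p + clen c1 + clen c2, m2)"
    by (rule execD[OF assms(2), where pre = "pre @ comp ?p c1"]) auto
  show "\<exists>t\<le>T1 + T2. run ?P t (?p, m) = (?p + clen (LSeq c1 c2), m2)"
    using run_trans[OF f0 f1] by (simp add: add.assoc)
qed

text \<open>Only this branch ends with an emulated jump over the other one, hence register 2 is
  cleared here and not in the zero case.\<close>

lemma exec_If_nonzero:
  assumes "m r \<noteq> 0" and "exec c1 m m1 T"
  shows "exec (LIf r c1 c2) m (m1(2 := 0)) (T + 3)"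
  unfolding exec_def
proof (intro allI)
  fix pre post
  let ?P = "pre @ comp (length pre) (LIf r c1 c2) @ post" and ?p = "length pre"
  let ?q = "?p + 1 + clen c1"
  have f0: "\<exists>t\<le>Suc 0. run ?P t (?p, m) = (?p + 1, m)"
    using assms(1) by (intro run_step) (subst step_Jz, auto)
  have f1: "\<exists>t\<le>T. run ?P t (?p + 1, m) = (?q, m1)"
    by (rule execD[OF assms(2), where pre = "pre @ [Jz r (?p + clen c1 + 3)]"]) auto
  have f2: "\<exists>t\<le>Suc 0. run ?P t (?q, m1) = (?q + 1, m1(2 := 0))"
    by (intro run_step, subst step_basic[where pre = "pre @ [Jz r (?p + clen c1 + 3)] @ comp (?p + 1) c1"]) auto
  have f3: "\<exists>t\<le>Suc 0. run ?P t (?q + 1, m1(2 := 0)) = (?p + clen (LIf r c1 c2), m1(2 := 0))"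
    by (intro run_step, subst step_Jz[where
          pre = "pre @ [Jz r (?p + clen c1 + 3)] @ comp (?p + 1) c1 @ [LoadC 2 0]"]) auto
  have "\<exists>t\<le>Suc 0 + T + Suc 0 + Suc 0.
      run ?P t (?p, m) = (?p + clen (LIf r c1 c2), m1(2 := 0))"
    by (rule run_trans[OF run_trans[OF run_trans[OF f0 f1] f2] f3])
  then show "\<exists>t\<le>T + 3. run ?P t (?p, m) = (?p + clen (LIf r c1 c2), m1(2 := 0))"
    by (simp add: numeral_3_eq_3)
qed

lemma exec_If_zero:
  assumes "m r = 0" and "exec c2 m m1 T"
  shows "exec (LIf r c1 c2) m m1 (T + 3)"
  unfolding exec_def
proof (intro allI)
  fix pre post
  let ?P = "pre @ comp (length pre) (LIf r c1 c2) @ post" and ?p = "length pre"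
  have f0: "\<exists>t\<le>Suc 0. run ?P t (?p, m) = (?p + clen c1 + 3, m)"
    using assms(1) by (intro run_step) (subst step_Jz, auto)
  have f1: "\<exists>t\<le>T. run ?P t (?p + clen c1 + 3, m) = (?p + clen c1 + 3 + clen c2, m1)"
    by (rule execD[OF assms(2), where pre = "pre @ [Jz r (?p + clen c1 + 3)] @ comp (?p + 1) c1 @
          [LoadC 2 0, Jz 2 (?p + clen c1 + clen c2 + 3)]"]) auto
  have "\<exists>t\<le>Suc 0 + T. run ?P t (?p, m) = (?p + clen c1 + 3 + clen c2, m1)"
    by (rule run_trans[OF f0 f1])
  then obtain t where "t \<le> Suc 0 + T" "run ?P t (?p, m) = (?p + clen c1 + 3 + clen c2, m1)"
    by blast
  then show "\<exists>t\<le>T + 3. run ?P t (?p, m) = (?p + clen (LIf r c1 c2), m1)"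
    by (intro exI[of _ t]) (auto simp: algebra_simps)
qed

lemma exec_While_zero:
  assumes "m r = 0"
  shows "exec (LWhile r c) m m 1"
  unfolding exec_def
proof (intro allI)
  fix pre post
  let ?P = "pre @ comp (length pre) (LWhile r c) @ post" and ?p = "length pre"
  have f0: "\<exists>t\<le>Suc 0. run ?P t (?p, m) = (?p + clen c + 3, m)"
    using assms by (intro run_step) (subst step_Jz, auto)
  then show "\<exists>t\<le>1. run ?P t (?p, m) = (?p + clen (LWhile r c), m)"
    by (simp add: algebra_simps)
qed

lemma exec_While_nonzero:
  assumes "m r \<noteq> 0" and "exec c m m1 T1" and "exec (LWhile r c) (m1(2 := 0)) m2 T2"
  shows "exec (LWhile r c) m m2 (T1 + 3 + T2)"
  unfolding exec_def
proof (intro allI)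
  fix pre post
  let ?P = "pre @ comp (length pre) (LWhile r c) @ post" and ?p = "length pre"
  let ?q = "?p + 1 + clen c"
  have f0: "\<exists>t\<le>Suc 0. run ?P t (?p, m) = (?p + 1, m)"
    using assms(1) by (intro run_step) (subst step_Jz, auto)
  have f1: "\<exists>t\<le>T1. run ?P t (?p + 1, m) = (?q, m1)"
    by (rule execD[OF assms(2), where pre = "pre @ [Jz r (?p + clen c + 3)]"]) auto
  have f2: "\<exists>t\<le>Suc 0. run ?P t (?q, m1) = (?q + 1, m1(2 := 0))"
    by (intro run_step, subst step_basic[where pre = "pre @ [Jz r (?p + clen c + 3)] @ comp (?p + 1) c"]) auto
  have f3: "\<exists>t\<le>Suc 0. run ?P t (?q + 1, m1(2 := 0)) = (?p, m1(2 := 0))"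
    by (intro run_step, subst step_Jz[where
          pre = "pre @ [Jz r (?p + clen c + 3)] @ comp (?p + 1) c @ [LoadC 2 0]"]) auto
  have f4: "\<exists>t\<le>T2. run ?P t (?p, m1(2 := 0)) = (?p + clen (LWhile r c), m2)"
    by (rule execD[OF assms(3)]) auto
  have "\<exists>t\<le>Suc 0 + T1 + Suc 0 + Suc 0 + T2.
      run ?P t (?p, m) = (?p + clen (LWhile r c), m2)"
    by (rule run_trans[OF run_trans[OF run_trans[OF run_trans[OF f0 f1] f2] f3] f4])
  then show "\<exists>t\<le>T1 + 3 + T2. run ?P t (?p, m) = (?p + clen (LWhile r c), m2)"
    by (simp add: numeral_3_eq_3)
qed

text \<open>Invariant and measure are required of \<open>m1(2 := 0)\<close> because the jump back
  clears register 2 before the next test.\<close>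

lemma exec_While:
  assumes step: "\<And>m. I m \<Longrightarrow> m r \<noteq> 0 \<Longrightarrow> \<exists>m1. exec c m m1 T \<and> I (m1(2 := 0)) \<and> \<mu> (m1(2 := 0)) < (\<mu> m :: nat)"
    and "I m"
  shows "\<exists>m'. exec (LWhile r c) m m' ((\<mu> m + 1) * (T + 3)) \<and> I m' \<and> m' r = 0"
  using \<open>I m\<close>
proof (induction "\<mu> m" arbitrary: m rule: less_induct)
  case less
  show ?case
  proof (cases "m r = 0")
    case True
    then have "exec (LWhile r c) m m ((\<mu> m + 1) * (T + 3))"
      by (intro exec_mono[OF exec_While_zero]) auto
    with True less.prems show ?thesis by blast
  next
    case False
    obtain m1 where m1: "exec c m m1 T" "I (m1(2 := 0))" "\<mu> (m1(2 := 0)) < \<mu> m"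
      using step[OF less.prems False] by blast
    obtain m' where m': "exec (LWhile r c) (m1(2 := 0)) m' ((\<mu> (m1(2 := 0)) + 1) * (T + 3))"
        "I m'" "m' r = 0"
      using less.hyps[OF m1(3) m1(2)] by blast
    have "exec (LWhile r c) m m' (T + 3 + (\<mu> (m1(2 := 0)) + 1) * (T + 3))"
      by (rule exec_While_nonzero[OF False m1(1) m'(1)])
    moreover have "T + 3 + (\<mu> (m1(2 := 0)) + 1) * (T + 3) \<le> (\<mu> m + 1) * (T + 3)"
      using mult_le_mono1[of "\<mu> (m1(2 := 0)) + 1 + 1" "\<mu> m + 1" "T + 3"] m1(3)
      by (simp add: algebra_simps)
    ultimately show ?thesis using m'(2,3) exec_mono[of "LWhile r c" m m'] by blast
  qed
qed

section \<open>Commands over variables and eight arrays, and their simulation on the machine\<close>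

type_synonym state = "(nat \<Rightarrow> nat) \<times> (nat \<Rightarrow> nat \<Rightarrow> nat)"

datatype aexp =
    N nat
  | V nat
  | Plus aexp aexp  (infixl "\<oplus>" 65)
  | Minus aexp aexp  (infixl "\<ominus>" 65)
  | Arr nat aexp

datatype com =
    Asg nat aexp
  | Wr nat aexp aexp
  | Seq com com  (infixr ";;" 60)
  | Cond aexp com com
  | While aexp com

fun val :: "aexp \<Rightarrow> state \<Rightarrow> nat" where
  "val (N c) \<sigma> = c"
| "val (V x) \<sigma> = fst \<sigma> x"
| "val (a \<oplus> b) \<sigma> = val a \<sigma> + val b \<sigma>"
| "val (a \<ominus> b) \<sigma> = val a \<sigma> - val b \<sigma>"
| "val (Arr k a) \<sigma> = snd \<sigma> k (val a \<sigma>)"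

fun wf_exp :: "aexp \<Rightarrow> bool" where
  "wf_exp (N c) = True"
| "wf_exp (V x) = (x < 24)"
| "wf_exp (a \<oplus> b) = (wf_exp a \<and> wf_exp b)"
| "wf_exp (a \<ominus> b) = (wf_exp a \<and> wf_exp b)"
| "wf_exp (Arr k a) = (k < 8 \<and> wf_exp a)"

text \<open>The number of temporaries needed: the left operand stays in its register while the right
  one is evaluated one register higher.\<close>

fun depth :: "aexp \<Rightarrow> nat" where
  "depth (N c) = 1"
| "depth (V x) = 1"
| "depth (a \<oplus> b) = max (depth a) (depth b + 1)"
| "depth (a \<ominus> b) = max (depth a) (depth b + 1)"
| "depth (Arr k a) = depth a"

text \<open>Variables fill registers 6 to 29. The right side of \<open>Wr\<close> starts at register
  31, and depth 30 still keeps it below 64.\<close>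

fun wf_com :: "com \<Rightarrow> bool" where
  "wf_com (Asg x e) = (x < 24 \<and> wf_exp e \<and> depth e \<le> 30)"
| "wf_com (Wr k e1 e2) = (k < 8 \<and> wf_exp e1 \<and> wf_exp e2 \<and> depth e1 \<le> 30 \<and> depth e2 \<le> 30)"
| "wf_com (c1 ;; c2) = (wf_com c1 \<and> wf_com c2)"
| "wf_com (Cond e c1 c2) = (wf_exp e \<and> depth e \<le> 30 \<and> wf_com c1 \<and> wf_com c2)"
| "wf_com (While e c) = (wf_exp e \<and> depth e \<le> 30 \<and> wf_com c)"

text \<open>Variable \<open>x\<close> lives in register \<open>6 + x\<close>, temporaries in registers 30 to 63, and the eight
  arrays are interleaved above the base address kept in register 5.\<close>

definition addr :: "nat \<Rightarrow> nat \<Rightarrow> instr list" where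
  "addr k t = [Add t t t, Add t t t, Add t t t, Add t t 5, LoadC 2 k, Add t t 2]"

text \<open>There is no copy instruction, so a variable is read by adding a cleared register
  2.\<close>

fun tre :: "aexp \<Rightarrow> nat \<Rightarrow> instr list" where
  "tre (N c) t = [LoadC t c]"
| "tre (V x) t = [LoadC 2 0, Add t (6 + x) 2]"
| "tre (a \<oplus> b) t = tre a t @ tre b (t + 1) @ [Add t t (t + 1)]"
| "tre (a \<ominus> b) t = tre a t @ tre b (t + 1) @ [Sub t t (t + 1)]"
| "tre (Arr k a) t = tre a t @ addr k t @ [Load t t]"

text \<open>\<open>LWhile\<close> tests register 30 only, so the guard is evaluated before the loop
  and again at the end of every round.\<close>

fun tr :: "com \<Rightarrow> lcom" where
  "tr (Asg x e) = Block (tre e 30 @ [LoadC 2 0, Add (6 + x) 30 2])"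
| "tr (Wr k e1 e2) = Block (tre e1 30 @ addr k 30 @ tre e2 31 @ [Store 30 31])"
| "tr (c1 ;; c2) = LSeq (tr c1) (tr c2)"
| "tr (Cond e c1 c2) = LSeq (Block (tre e 30)) (LIf 30 (tr c1) (tr c2))"
| "tr (While e c) = LSeq (Block (tre e 30)) (LWhile 30 (LSeq (tr c) (Block (tre e 30))))"

text \<open>Interleaving gives every array unbounded length above one base. Register 2 and the
  temporaries are left unconstrained.\<close>

definition rel :: "nat \<Rightarrow> state \<Rightarrow> mem \<Rightarrow> bool" where
  "rel B \<sigma> m \<longleftrightarrow> B \<ge> 64 \<and> m 5 = B \<and> (\<forall>x<24. m (6 + x) = fst \<sigma> x) \<and>
     (\<forall>k<8. \<forall>i. m (B + 8 * i + k) = snd \<sigma> k i)"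

lemma basic_addr: "i \<in> set (addr k t) \<Longrightarrow> basic i"
  by (auto simp: addr_def)

lemma basic_tre: "i \<in> set (tre e t) \<Longrightarrow> basic i"
  by (induction e arbitrary: t) (auto dest: basic_addr)

lemma depth_pos: "0 < depth e"
  by (induction e) auto

definition frame :: "nat \<Rightarrow> mem \<Rightarrow> mem \<Rightarrow> bool" where
  "frame t m m' \<longleftrightarrow> (\<forall>i. i \<noteq> 2 \<and> (i < t \<or> i \<ge> 64) \<longrightarrow> m' i = m i)"

lemma rel_frame: "rel B \<sigma> m \<Longrightarrow> frame t m m' \<Longrightarrow> t \<ge> 30 \<Longrightarrow> rel B \<sigma> m'"
  by (auto simp: rel_def frame_def)

text \<open>Three doublings multiply the index by 8, the stride of the interleaved arrays.\<close>

lemma addr_correct: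
  assumes "m 5 = B" and "30 \<le> t" and "t < 64"
  shows "fold eff (addr k t) m t = B + 8 * m t + k \<and> frame t m (fold eff (addr k t) m)"
  using assms by (auto simp: addr_def frame_def)

text \<open>The left value survives in register \<open>t\<close> because the right operand,
  evaluated from \<open>t + 1\<close>, frames everything below except register 2.\<close>

lemma tre_correct:
  assumes "rel B \<sigma> m" and "wf_exp e" and "30 \<le> t" and "t + depth e \<le> 64"
  shows "fold eff (tre e t) m t = val e \<sigma> \<and> frame t m (fold eff (tre e t) m)"
  using assms
proof (induction e arbitrary: t m)
  case (N c)
  then show ?case by (auto simp: frame_def)
next
  case (V x)
  then show ?case by (auto simp: frame_def rel_def)
next
  case (Plus a b)
  let ?m1 = "fold eff (tre a t) m" and ?m2 = "fold eff (tre b (t + 1)) (fold eff (tre a t) m)"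
  have 1: "?m1 t = val a \<sigma>" "frame t m ?m1"
    using Plus.IH(1)[OF Plus.prems(1)] Plus.prems by auto
  have 2: "?m2 (t + 1) = val b \<sigma>" "frame (t + 1) ?m1 ?m2"
    using Plus.IH(2)[OF rel_frame[OF Plus.prems(1) 1(2)], of "t + 1"] Plus.prems by auto
  have "?m2 t = val a \<sigma>" using 1 2 Plus.prems by (auto simp: frame_def)
  with 2 1 Plus.prems show ?case by (auto simp: frame_def)
next
  case (Minus a b)
  let ?m1 = "fold eff (tre a t) m" and ?m2 = "fold eff (tre b (t + 1)) (fold eff (tre a t) m)"
  have 1: "?m1 t = val a \<sigma>" "frame t m ?m1"
    using Minus.IH(1)[OF Minus.prems(1)] Minus.prems by auto
  have 2: "?m2 (t + 1) = val b \<sigma>" "frame (t + 1) ?m1 ?m2"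
    using Minus.IH(2)[OF rel_frame[OF Minus.prems(1) 1(2)], of "t + 1"] Minus.prems by auto
  have "?m2 t = val a \<sigma>" using 1 2 Minus.prems by (auto simp: frame_def)
  with 2 1 Minus.prems show ?case by (auto simp: frame_def)
next
  case (Arr k a)
  let ?m1 = "fold eff (tre a t) m" and ?m2 = "fold eff (addr k t) (fold eff (tre a t) m)"
  have 1: "?m1 t = val a \<sigma>" "frame t m ?m1"
    using Arr.IH[OF Arr.prems(1)] Arr.prems by auto
  have t: "t < 64" using Arr.prems depth_pos[of a] by simp
  have r1: "rel B \<sigma> ?m1" using rel_frame[OF Arr.prems(1) 1(2)] Arr.prems by simp
  then have 2: "?m2 t = B + 8 * val a \<sigma> + k" "frame t ?m1 ?m2"
    using addr_correct[of ?m1 B t k] Arr.prems 1 t by (auto simp: rel_def)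
  have "rel B \<sigma> ?m2" using rel_frame[OF r1 2(2)] Arr.prems by simp
  then have "?m2 (?m2 t) = snd \<sigma> k (val a \<sigma>)"
    using 2(1) Arr.prems by (simp add: rel_def)
  with 1 2 t show ?case by (auto simp: frame_def)
qed

text \<open>The base \<open>B\<close> is quantified inside, so the same code works for inputs of
  every length.\<close>

definition exec2 :: "com \<Rightarrow> state \<Rightarrow> state \<Rightarrow> nat \<Rightarrow> bool" where
  "exec2 c \<sigma> \<sigma>' T \<longleftrightarrow> (\<forall>B m. rel B \<sigma> m \<longrightarrow> (\<exists>m'. exec (tr c) m m' T \<and> rel B \<sigma>' m'))"

lemma exec2_mono: "exec2 c \<sigma> \<sigma>' T \<Longrightarrow> T \<le> T' \<Longrightarrow> exec2 c \<sigma> \<sigma>' T'"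
  unfolding exec2_def by (metis exec_mono)

lemma exec2_Seq: "exec2 c1 \<sigma> \<sigma>1 T1 \<Longrightarrow> exec2 c2 \<sigma>1 \<sigma>2 T2 \<Longrightarrow> exec2 (c1 ;; c2) \<sigma> \<sigma>2 (T1 + T2)"
  unfolding exec2_def
proof (intro allI impI)
  fix B m
  assume 1: "\<forall>B m. rel B \<sigma> m \<longrightarrow> (\<exists>m'. exec (tr c1) m m' T1 \<and> rel B \<sigma>1 m')"
    and 2: "\<forall>B m. rel B \<sigma>1 m \<longrightarrow> (\<exists>m'. exec (tr c2) m m' T2 \<and> rel B \<sigma>2 m')"
    and r: "rel B \<sigma> m"
  obtain m1 where m1: "exec (tr c1) m m1 T1" "rel B \<sigma>1 m1" using 1 r by blast
  obtain m2 where m2: "exec (tr c2) m1 m2 T2" "rel B \<sigma>2 m2" using 2 m1(2) by blast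
  show "\<exists>m'. exec (tr (c1 ;; c2)) m m' (T1 + T2) \<and> rel B \<sigma>2 m'"
    unfolding tr.simps using exec_Seq[OF m1(1) m2(1)] m2(2) by blast
qed

fun assign :: "nat \<Rightarrow> nat \<Rightarrow> state \<Rightarrow> state" where
  "assign x a (s, A) = (s(x := a), A)"

fun store :: "nat \<Rightarrow> nat \<Rightarrow> nat \<Rightarrow> state \<Rightarrow> state" where
  "store k i a (s, A) = (s, A(k := (A k)(i := a)))"

lemma exec2_Asg:
  assumes "wf_com (Asg x e)"
  shows "exec2 (Asg x e) \<sigma> (assign x (val e \<sigma>) \<sigma>) (length (tre e 30) + 2)"
  unfolding exec2_def
proof (intro allI impI)
  fix B m assume r: "rel B \<sigma> m"
  let ?m1 = "fold eff (tre e 30) m"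
  let ?cs = "tre e 30 @ [LoadC 2 0, Add (6 + x) 30 2]"
  have 1: "?m1 30 = val e \<sigma>" "frame 30 m ?m1"
    using tre_correct[OF r, of e 30] assms by auto
  have r1: "rel B \<sigma> ?m1" using rel_frame[OF r 1(2)] by simp
  have "fold eff ?cs m = ?m1(2 := 0, 6 + x := val e \<sigma>)" using 1 by simp
  moreover have "rel B (assign x (val e \<sigma>) \<sigma>) (?m1(2 := 0, 6 + x := val e \<sigma>))"
    using r1 assms by (cases \<sigma>) (auto simp: rel_def)
  moreover have "exec (tr (Asg x e)) m (fold eff ?cs m) (length ?cs)"
    unfolding tr.simps by (rule exec_Block) (auto dest: basic_tre)
  moreover have "length ?cs = length (tre e 30) + 2" by simp
  ultimately show "\<exists>m'. exec (tr (Asg x e)) m m' (length (tre e 30) + 2) \<and> rel B (assign x (val e \<sigma>) \<sigma>) m'"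
    by metis
qed

lemma interleave_inj:
  fixes k k' i i' :: nat
  assumes "k < 8" and "k' < 8"
  shows "8 * i + k = 8 * i' + k' \<longleftrightarrow> i = i' \<and> k = k'"
proof
  assume eq: "8 * i + k = 8 * i' + k'"
  have "(8 * i + k) mod 8 = k" "(8 * i' + k') mod 8 = k'" using assms by simp_all
  then have "k = k'" using eq by metis
  then show "i = i' \<and> k = k'" using eq by simp
qed simp

lemma exec2_Wr:
  assumes "wf_com (Wr k e1 e2)"
  shows "exec2 (Wr k e1 e2) \<sigma> (store k (val e1 \<sigma>) (val e2 \<sigma>) \<sigma>)
    (length (tre e1 30) + length (tre e2 31) + 7)"
  unfolding exec2_def
proof (intro allI impI)
  fix B m assume r: "rel B \<sigma> m"
  let ?m1 = "fold eff (tre e1 30) m"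
  let ?m2 = "fold eff (addr k 30) ?m1"
  let ?m3 = "fold eff (tre e2 31) ?m2"
  let ?cs = "tre e1 30 @ addr k 30 @ tre e2 31 @ [Store 30 31]"
  have 1: "?m1 30 = val e1 \<sigma>" "frame 30 m ?m1"
    using tre_correct[OF r, of e1 30] assms by auto
  have r1: "rel B \<sigma> ?m1" using rel_frame[OF r 1(2)] by simp
  then have 2: "?m2 30 = B + 8 * val e1 \<sigma> + k" "frame 30 ?m1 ?m2"
    using addr_correct[of ?m1 B 30 k] 1 by (auto simp: rel_def)
  have r2: "rel B \<sigma> ?m2" using rel_frame[OF r1 2(2)] by simp
  have 3: "?m3 31 = val e2 \<sigma>" "frame 31 ?m2 ?m3"
    using tre_correct[OF r2, of e2 31] assms by auto
  have r3: "rel B \<sigma> ?m3" using rel_frame[OF r2 3(2)] by simp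
  have "?m3 30 = B + 8 * val e1 \<sigma> + k" using 2 3 by (simp add: frame_def)
  then have "fold eff ?cs m = ?m3(B + 8 * val e1 \<sigma> + k := val e2 \<sigma>)" using 3 by simp
  moreover have "rel B (store k (val e1 \<sigma>) (val e2 \<sigma>) \<sigma>) (?m3(B + 8 * val e1 \<sigma> + k := val e2 \<sigma>))"
    using r3 assms by (cases \<sigma>) (auto simp: rel_def add.assoc interleave_inj)
  moreover have "exec (tr (Wr k e1 e2)) m (fold eff ?cs m) (length ?cs)"
    unfolding tr.simps by (rule exec_Block) (auto dest: basic_tre basic_addr)
  moreover have "length ?cs = length (tre e1 30) + length (tre e2 31) + 7"
    by (simp add: addr_def)
  ultimately show "\<exists>m'. exec (tr (Wr k e1 e2)) m m' (length (tre e1 30) + length (tre e2 31) + 7) \<and>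
      rel B (store k (val e1 \<sigma>) (val e2 \<sigma>) \<sigma>) m'"
    by metis
qed

lemma exec2_guard:
  assumes "wf_exp e" and "depth e \<le> 30" and "rel B \<sigma> m"
  shows "\<exists>m'. exec (Block (tre e 30)) m m' (length (tre e 30)) \<and> rel B \<sigma> m' \<and> m' 30 = val e \<sigma>"
proof -
  have "fold eff (tre e 30) m 30 = val e \<sigma> \<and> frame 30 m (fold eff (tre e 30) m)"
    using tre_correct[OF assms(3), of e 30] assms by auto
  moreover have "exec (Block (tre e 30)) m (fold eff (tre e 30) m) (length (tre e 30))"
    by (rule exec_Block) (auto dest: basic_tre)
  ultimately show ?thesis using rel_frame[OF assms(3), of 30] by blast
qed

lemma rel_upd2: "rel B \<sigma> m \<Longrightarrow> rel B \<sigma> (m(2 := a))"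
  by (auto simp: rel_def)

lemma exec2_If:
  assumes "wf_exp e" and "depth e \<le> 30"
    and "val e \<sigma> \<noteq> 0 \<Longrightarrow> exec2 c1 \<sigma> \<sigma>' T" and "val e \<sigma> = 0 \<Longrightarrow> exec2 c2 \<sigma> \<sigma>' T"
  shows "exec2 (Cond e c1 c2) \<sigma> \<sigma>' (length (tre e 30) + (T + 3))"
  unfolding exec2_def
proof (intro allI impI)
  fix B m assume "rel B \<sigma> m"
  then obtain m1 where m1: "exec (Block (tre e 30)) m m1 (length (tre e 30))" "rel B \<sigma> m1" "m1 30 = val e \<sigma>"
    using exec2_guard assms by blast
  have "\<exists>m'. exec (LIf 30 (tr c1) (tr c2)) m1 m' (T + 3) \<and> rel B \<sigma>' m'" (is "\<exists>m'. ?Q m'")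
  proof (cases "val e \<sigma> = 0")
    case True
    with assms(4) m1(2) obtain m2 where "exec (tr c2) m1 m2 T" "rel B \<sigma>' m2"
      unfolding exec2_def by blast
    then have "exec (LIf 30 (tr c1) (tr c2)) m1 m2 (T + 3) \<and> rel B \<sigma>' m2"
      using True m1(3) exec_If_zero by simp
    then show ?thesis by blast
  next
    case False
    with assms(3) m1(2) obtain m2 where "exec (tr c1) m1 m2 T" "rel B \<sigma>' m2"
      unfolding exec2_def by blast
    then have "exec (LIf 30 (tr c1) (tr c2)) m1 (m2(2 := 0)) (T + 3) \<and> rel B \<sigma>' (m2(2 := 0))"
      using False m1(3) exec_If_nonzero rel_upd2 by simp
    then show ?thesis by blast
  qed
  then obtain m2 where m2: "?Q m2" by blast
  then show "\<exists>m'. exec (tr (Cond e c1 c2)) m m' (length (tre e 30) + (T + 3)) \<and> rel B \<sigma>' m'"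
    unfolding tr.simps using exec_Seq[OF m1(1), of _ m2 "T + 3"] by blast
qed

text \<open>This is the loop entered with its guard already in register 30, the situation at the
  head of each round, which is what the induction needs. The final state is chosen before
  \<open>B\<close> and \<open>m\<close>.\<close>

lemma exec2_While_aux:
  assumes e: "wf_exp e" "depth e \<le> 30"
    and step: "\<And>\<sigma>. I \<sigma> \<Longrightarrow> val e \<sigma> \<noteq> 0 \<Longrightarrow> \<exists>\<sigma>1. exec2 c \<sigma> \<sigma>1 T \<and> I \<sigma>1 \<and> \<mu> \<sigma>1 < (\<mu> \<sigma> :: nat)"
    and "I \<sigma>"
  shows "\<exists>\<sigma>'. I \<sigma>' \<and> val e \<sigma>' = 0 \<and> (\<forall>B m. rel B \<sigma> m \<longrightarrow> m 30 = val e \<sigma> \<longrightarrow>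
    (\<exists>m'. exec (LWhile 30 (LSeq (tr c) (Block (tre e 30)))) m m'
      ((\<mu> \<sigma> + 1) * (T + length (tre e 30) + 3)) \<and> rel B \<sigma>' m'))"
  using \<open>I \<sigma>\<close>
proof (induction "\<mu> \<sigma>" arbitrary: \<sigma> rule: less_induct)
  case less
  let ?W = "LWhile 30 (LSeq (tr c) (Block (tre e 30)))"
  let ?T = "T + length (tre e 30) + 3"
  show ?case
  proof (cases "val e \<sigma> = 0")
    case True
    have "exec ?W m m ((\<mu> \<sigma> + 1) * ?T)" if "m 30 = val e \<sigma>" for m
      using True that by (intro exec_mono[OF exec_While_zero]) auto
    with True less.prems show ?thesis by blast
  next
    case False
    obtain \<sigma>1 where s1: "exec2 c \<sigma> \<sigma>1 T" "I \<sigma>1" "\<mu> \<sigma>1 < \<mu> \<sigma>"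
      using step[OF less.prems False] by blast
    obtain \<sigma>' where s': "I \<sigma>'" "val e \<sigma>' = 0" "\<forall>B m. rel B \<sigma>1 m \<longrightarrow> m 30 = val e \<sigma>1 \<longrightarrow>
        (\<exists>m'. exec ?W m m' ((\<mu> \<sigma>1 + 1) * ?T) \<and> rel B \<sigma>' m')"
      using less.hyps[OF s1(3) s1(2)] by blast
    have T: "(T + length (tre e 30)) + 3 + (\<mu> \<sigma>1 + 1) * ?T \<le> (\<mu> \<sigma> + 1) * ?T"
      using mult_le_mono1[of "\<mu> \<sigma>1 + 1 + 1" "\<mu> \<sigma> + 1" ?T] s1(3)
      by (simp add: algebra_simps)
    have "\<exists>m'. exec ?W m m' ((\<mu> \<sigma> + 1) * ?T) \<and> rel B \<sigma>' m'" if r: "rel B \<sigma> m" and g: "m 30 = val e \<sigma>" for B m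
    proof -
      obtain m1 where m1: "exec (tr c) m m1 T" "rel B \<sigma>1 m1"
        using s1(1)[unfolded exec2_def, rule_format, OF r] by blast
      obtain m2 where m2: "exec (Block (tre e 30)) m1 m2 (length (tre e 30))" "rel B \<sigma>1 m2"
          "m2 30 = val e \<sigma>1"
        using exec2_guard[OF e m1(2)] by blast
      obtain m' where m': "exec ?W (m2(2 := 0)) m' ((\<mu> \<sigma>1 + 1) * ?T)" "rel B \<sigma>' m'"
        using s'(3)[rule_format, OF rel_upd2[OF m2(2), of 0]] m2(3) by auto
      have "exec ?W m m' ((T + length (tre e 30)) + 3 + (\<mu> \<sigma>1 + 1) * ?T)"
        using False g by (intro exec_While_nonzero[OF _ exec_Seq[OF m1(1) m2(1)] m'(1)]) simp
      then show ?thesis using exec_mono[OF _ T] m'(2) by blast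
    qed
    with s' show ?thesis by blast
  qed
qed

lemma exec2_While:
  assumes e: "wf_exp e" "depth e \<le> 30"
    and step: "\<And>\<sigma>. I \<sigma> \<Longrightarrow> val e \<sigma> \<noteq> 0 \<Longrightarrow> \<exists>\<sigma>1. exec2 c \<sigma> \<sigma>1 T \<and> I \<sigma>1 \<and> \<mu> \<sigma>1 < (\<mu> \<sigma> :: nat)"
    and "I \<sigma>"
  shows "\<exists>\<sigma>'. exec2 (While e c) \<sigma> \<sigma>' ((\<mu> \<sigma> + 2) * (T + length (tre e 30) + 3)) \<and> I \<sigma>' \<and> val e \<sigma>' = 0"
proof -
  let ?W = "LWhile 30 (LSeq (tr c) (Block (tre e 30)))"
  let ?T = "T + length (tre e 30) + 3"
  obtain \<sigma>' where s': "I \<sigma>'" "val e \<sigma>' = 0" "\<forall>B m. rel B \<sigma> m \<longrightarrow> m 30 = val e \<sigma> \<longrightarrow>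
      (\<exists>m'. exec ?W m m' ((\<mu> \<sigma> + 1) * ?T) \<and> rel B \<sigma>' m')"
    using exec2_While_aux[of e I c T \<mu>, OF assms] by blast
  have T: "length (tre e 30) + (\<mu> \<sigma> + 1) * ?T \<le> (\<mu> \<sigma> + 2) * ?T"
    by (simp add: algebra_simps)
  have "exec2 (While e c) \<sigma> \<sigma>' ((\<mu> \<sigma> + 2) * ?T)"
    unfolding exec2_def
  proof (intro allI impI)
    fix B m assume "rel B \<sigma> m"
    then obtain m1 where m1: "exec (Block (tre e 30)) m m1 (length (tre e 30))" "rel B \<sigma> m1" "m1 30 = val e \<sigma>"
      using exec2_guard e by blast
    then obtain m' where m': "exec ?W m1 m' ((\<mu> \<sigma> + 1) * ?T)" "rel B \<sigma>' m'"
      using s'(3) by blast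
    show "\<exists>m'. exec (tr (While e c)) m m' ((\<mu> \<sigma> + 2) * ?T) \<and> rel B \<sigma>' m'"
      unfolding tr.simps using exec_mono[OF exec_Seq[OF m1(1) m'(1)] T] m'(2) by blast
  qed
  with s' show ?thesis by blast
qed

section \<open>Loop-free commands as state functions of constant cost\<close>

fun loop_free :: "com \<Rightarrow> bool" where
  "loop_free (c1 ;; c2) = (loop_free c1 \<and> loop_free c2)"
| "loop_free (Cond e c1 c2) = (loop_free c1 \<and> loop_free c2)"
| "loop_free (While e c) = False"
| "loop_free _ = True"

text \<open>The \<open>While\<close> clause is a placeholder value; correctness is claimed under
  \<open>loop_free\<close>.\<close>

fun sem :: "com \<Rightarrow> state \<Rightarrow> state" where
  "sem (Asg x e) \<sigma> = assign x (val e \<sigma>) \<sigma>"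
| "sem (Wr k e1 e2) \<sigma> = store k (val e1 \<sigma>) (val e2 \<sigma>) \<sigma>"
| "sem (c1 ;; c2) \<sigma> = sem c2 (sem c1 \<sigma>)"
| "sem (Cond e c1 c2) \<sigma> = (if val e \<sigma> \<noteq> 0 then sem c1 \<sigma> else sem c2 \<sigma>)"
| "sem (While e c) \<sigma> = \<sigma>"

text \<open>Adding both branches of a conditional bounds the time by a number that depends on the
  syntax alone. This makes the cost of a round an absolute constant.\<close>

fun cost :: "com \<Rightarrow> nat" where
  "cost (Asg x e) = length (tre e 30) + 2"
| "cost (Wr k e1 e2) = length (tre e1 30) + length (tre e2 31) + 7"
| "cost (c1 ;; c2) = cost c1 + cost c2"
| "cost (Cond e c1 c2) = length (tre e 30) + (cost c1 + cost c2 + 3)"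
| "cost (While e c) = 0"

lemma exec2_loop_free:
  assumes "loop_free c" and "wf_com c"
  shows "exec2 c \<sigma> (sem c \<sigma>) (cost c)"
  using assms
proof (induction c arbitrary: \<sigma>)
  case (Asg x e)
  then show ?case using exec2_Asg[of x e] by simp
next
  case (Wr k e1 e2)
  then show ?case using exec2_Wr[of k e1 e2] by simp
next
  case (Seq c1 c2)
  then show ?case by (simp add: exec2_Seq[OF Seq.IH(1) Seq.IH(2)])
next
  case (Cond e c1 c2)
  have "exec2 c1 \<sigma> (sem c1 \<sigma>) (cost c1 + cost c2)" "exec2 c2 \<sigma> (sem c2 \<sigma>) (cost c1 + cost c2)"
    using Cond by (simp_all add: exec2_mono[OF Cond.IH(1)] exec2_mono[OF Cond.IH(2)])
  then show ?case using Cond.prems unfolding cost.simps by (intro exec2_If) auto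
qed simp

section \<open>The combinatorial core\<close>

definition extends :: "(nat \<Rightarrow> nat \<Rightarrow> bool) \<Rightarrow> nat \<Rightarrow> nat \<Rightarrow> nat \<Rightarrow> bool" where
  "extends E a x w \<longleftrightarrow> (if w < a then E x w \<longrightarrow> E (x - 1) w else E x w)"

text \<open>Neighbourhoods in earlier segments are compared with those of the predecessor
  \<open>x - 1\<close> only; the inclusions compose along a segment.\<close>

definition appendable :: "(nat \<Rightarrow> nat \<Rightarrow> bool) \<Rightarrow> nat \<Rightarrow> nat \<Rightarrow> bool" where
  "appendable E a x \<longleftrightarrow> (\<forall>w\<in>{1..<x}. extends E a x w)"

text \<open>With the value 1 at the fictitious vertex 0, vertex 1 is appended vacuously and so
  belongs to segment 1, which starts at 1.\<close>

fun start :: "(nat \<Rightarrow> nat \<Rightarrow> bool) \<Rightarrow> nat \<Rightarrow> nat" where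
  "start E 0 = 1"
| "start E (Suc x) = (if appendable E (start E x) (Suc x) then start E x else Suc x)"

fun seg :: "(nat \<Rightarrow> nat \<Rightarrow> bool) \<Rightarrow> nat \<Rightarrow> nat" where
  "seg E 0 = 1"
| "seg E (Suc x) = (if appendable E (start E x) (Suc x) then seg E x else Suc (seg E x))"

lemma start_bounds: "1 \<le> start E x \<and> (1 \<le> x \<longrightarrow> start E x \<le> x)"
proof (induction x)
  case (Suc x)
  then show ?case by (cases x) auto
qed simp

lemma seg_mono: "x \<le> y \<Longrightarrow> seg E x \<le> seg E y"
  by (induction rule: dec_induct) auto

lemma seg_pos: "1 \<le> seg E x"
  using seg_mono[of 0 x E] by simp

text \<open>\<open>seg\<close> grows exactly when a segment opens, so equal values leave no opening
  between \<open>x\<close> and \<open>y\<close>.\<close>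

lemma start_eq_if_seg_eq:
  assumes "x \<le> y" and "seg E x = seg E y"
  shows "start E x = start E y"
  using assms
proof (induction rule: dec_induct)
  case (step z)
  have "seg E x \<le> seg E z" using seg_mono step.hyps by simp
  then show ?case using step by (auto split: if_splits)
qed simp

lemma segment_clique:
  assumes "start E y \<le> x" and "x < y"
  shows "E y x"
proof -
  obtain z where z: "y = Suc z" using assms(2) by (cases y) auto
  have ext: "appendable E (start E z) (Suc z)" and "start E y = start E z"
    using assms z by (auto split: if_splits)
  moreover have "1 \<le> x" using start_bounds[of E y] assms by simp
  ultimately show ?thesis using assms z by (auto simp: appendable_def extends_def dest!: bspec[of _ _ x])
qed

text \<open>Each append gave one inclusion between consecutive vertices; induction from
  \<open>x\<close> up to \<open>y\<close> chains them.\<close>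

lemma segment_shifted:
  assumes "1 \<le> x" and "x \<le> y" and "start E x = start E y" and "1 \<le> w" and "w < start E y" and "E y w"
  shows "E x w"
  using assms(2,3,5,6)
proof (induction rule: dec_induct)
  case (step z)
  have "start E x \<le> x" using start_bounds assms(1) by simp
  then have ext: "appendable E (start E z) (Suc z)" and eq: "start E (Suc z) = start E z"
    using step by (auto split: if_splits)
  have "start E z \<le> z" using start_bounds[of E z] assms(1) step.hyps by simp
  then have "w \<in> {1..<Suc z}" using step.prems eq assms(4) by simp
  then have "E z w" using ext step.prems eq by (auto simp: appendable_def extends_def dest!: bspec[of _ _ w])
  then show ?case using step.IH step.prems eq by simp
qed simp

text \<open>A greedy-stays-ahead argument: the greedy segmentation reaches each vertex with an index
  no larger than that of its segment in the given partition.\<close>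

lemma seg_le_shifted_clique:
  assumes "shifted_clique h E k" and "1 \<le> x" and "x \<le> h"
  shows "seg E x \<le> k"
proof -
  obtain b where b0: "b 0 = 1" and bk: "b k = h + 1"
    and mono: "\<forall>i\<in>{1..k}. b (i - 1) < b i"
    and clique: "\<forall>i\<in>{1..k}. \<forall>u\<in>{b (i - 1)..<b i}. \<forall>v\<in>{b (i - 1)..<b i}. u \<noteq> v \<longrightarrow> E u v"
    and shift: "\<forall>i\<in>{2..k}. \<forall>u\<in>{b (i - 1)..<b i}. \<forall>u'\<in>{b (i - 1)..<b i}. u < u' \<longrightarrow>
      (\<forall>w\<in>{1..<b (i - 1)}. E u' w \<longrightarrow> E u w)"
    using assms(1) unfolding shifted_clique_def by (elim exE conjE)
  note clique = clique[rule_format] and shift = shift[rule_format] and mono = mono[rule_format]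
  have b_pos: "1 \<le> b i" if "i \<le> k" for i
    using that
  proof (induction i)
    case (Suc i)
    then show ?case using mono[of "Suc i"] by simp
  qed (simp add: b0)
  \<comment> \<open>If the indices agree, the greedy segment must also start no earlier than the
    given one. This makes the claim inductive: the greedy segment then lies inside the given
    one.\<close>
  have greedy: "seg E y < i \<or> seg E y = i \<and> b (i - 1) \<le> start E y"
    if "i \<in> {1..k}" and "b (i - 1) \<le> y" and "y < b i" for y i
    using that
  proof (induction y arbitrary: i)
    case 0
    then have "i - 1 \<le> k" by auto
    then show ?case using b_pos[of "i - 1"] 0 by simp
  next
    case (Suc y)
    consider (inside) "b (i - 1) \<le> y" | (first) "i = 1" "y = 0" | (next_seg) "2 \<le> i" "b (i - 1) = Suc y"
      proof -
      have "i = 1 \<or> 2 \<le> i" using Suc.prems(1) by auto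
      then show ?thesis using Suc.prems(2) b0 that by fastforce
    qed
    then show ?case
    proof cases
      case inside
      then have IH: "seg E y < i \<or> seg E y = i \<and> b (i - 1) \<le> start E y"
        using Suc by simp
      \<comment> \<open>Vertices before the given segment are covered by its shift property. Inside
        it all pairs are adjacent, whether or not \<open>w\<close> precedes the greedy
        start.\<close>
      have "appendable E (start E y) (Suc y)" if start: "b (i - 1) \<le> start E y"
        unfolding appendable_def
      proof
        fix w assume w: "w \<in> {1..<Suc y}"
        have s: "start E y \<le> y" using start_bounds[of E y] w by auto
        show "extends E (start E y) (Suc y) w"
        proof (cases "w < b (i - 1)")
          case True
          then have "i \<in> {2..k}" using Suc.prems(1) b0 w by (cases "i = 1") auto
          then have "E (Suc y) w \<Longrightarrow> E y w"
            using shift[of i y "Suc y" w] Suc.prems inside True w by simp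
          then show ?thesis using True start by (simp add: extends_def)
        next
          case False
          then show ?thesis
            using clique[of i y w] clique[of i "Suc y" w] Suc.prems inside w s
            by (auto simp: extends_def)
        qed
      qed
      then show ?thesis using IH inside by auto
    next
      case first
      then show ?thesis using Suc.prems b0 by (simp add: appendable_def)
    next
      case next_seg
      then have i: "i - 1 \<in> {1..k}" using Suc.prems(1) by auto
      have "seg E y < i" using Suc.IH[OF i] mono[OF i] next_seg by linarith
      then show ?thesis using next_seg by auto
    qed
  qed
  define i where "i = (LEAST i. x < b i)"
  have "x < b k" using assms bk by simp
  then have i: "x < b i" "i \<le> k" unfolding i_def by (auto intro: LeastI Least_le)
  then have "i \<noteq> 0" using assms b0 by (intro notI) simp
  then have "\<not> x < b (i - 1)" unfolding i_def using not_less_Least[of "i - 1" "\<lambda>i. x < b i"]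
    by (simp add: i_def)
  then have "seg E x \<le> i" using greedy[of i x] i \<open>i \<noteq> 0\<close> by auto
  then show ?thesis using i by simp
qed

section \<open>Cut vectors as numerals in base \<open>n + 1\<close>, digit 1 least
  significant\<close>

fun num :: "nat \<Rightarrow> (nat \<Rightarrow> nat) \<Rightarrow> nat \<Rightarrow> nat" where
  "num b d 0 = 0"
| "num b d (Suc K) = num b d K + d (Suc K) * b ^ K"

lemma num_less:
  assumes "\<forall>s\<in>{1..K}. d s \<le> n"
  shows "num (n + 1) d K < (n + 1) ^ K"
  using assms
proof (induction K)
  case (Suc K)
  then have "num (n + 1) d K < (n + 1) ^ K" "d (Suc K) * (n + 1) ^ K \<le> n * (n + 1) ^ K"
    by (auto intro: mult_le_mono1)
  then have "num (n + 1) d K + d (Suc K) * (n + 1) ^ K < (n + 1) ^ K + n * (n + 1) ^ K"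
    by (rule add_less_le_mono)
  then show ?case by simp
qed simp

text \<open>The lower digits sum to less than \<open>(n + 1) ^ K\<close>, so division by this power
  isolates the top digit.\<close>

lemma num_inj:
  assumes "\<forall>s\<in>{1..K}. d s \<le> n" and "\<forall>s\<in>{1..K}. d' s \<le> n" and "num (n + 1) d K = num (n + 1) d' K"
  shows "\<forall>s\<in>{1..K}. d s = d' s"
  using assms
proof (induction K)
  case (Suc K)
  let ?b = "(n + 1) ^ K"
  have lt: "num (n + 1) d K < ?b" "num (n + 1) d' K < ?b" using num_less Suc.prems by auto
  have b: "?b > 0" by simp
  have "(num (n + 1) d K + d (Suc K) * ?b) div ?b = d (Suc K)"
    "(num (n + 1) d' K + d' (Suc K) * ?b) div ?b = d' (Suc K)"
    using lt b by simp_all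
  then have "d (Suc K) = d' (Suc K)" using Suc.prems(3) by (metis num.simps(2))
  moreover have "\<forall>s\<in>{1..K}. d s = d' s" using Suc calculation by simp
  ultimately show ?case using le_Suc_eq by auto
qed simp

text \<open>Both sides carry an added term in place of a difference, which would be truncated on
  \<open>nat\<close>.\<close>

lemma num_update:
  assumes "s \<in> {1..K}"
  shows "num b (d(s := a)) K + d s * b ^ (s - 1) = num b d K + a * b ^ (s - 1)"
  using assms
proof (induction K)
  case (Suc K)
  have other: "num b (d(s := a)) j = num b d j" if "j < s" for j
    using that by (induction j) auto
  show ?case
  proof (cases "s = Suc K")
    case True
    then have "num b (d(s := a)) K = num b d K" by (intro other) simp
    then show ?thesis using True by (simp add: fun_upd_def)
  next
    case False
    then show ?thesis using Suc by simp
  qed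
qed simp

lemma num_zero: "\<forall>s\<in>{1..K}. d s = 0 \<Longrightarrow> num b d K = 0"
  by (induction K) auto

section \<open>A fixed instance: cuts, violated pairs and forced increments\<close>

locale hom_instance =
  fixes h n :: nat and EH EG :: "nat \<Rightarrow> nat \<Rightarrow> bool" and low up :: "nat \<Rightarrow> nat"
  assumes graph_H: "ordered_graph h EH" and graph_G: "ordered_graph n EG"
    and ranges: "\<And>v. v \<in> {1..n} \<Longrightarrow> low v \<in> {1..h} \<and> up v \<in> {1..h}"
begin

lemma sym_H: "EH x y \<Longrightarrow> x \<in> {1..h} \<Longrightarrow> y \<in> {1..h} \<Longrightarrow> EH y x"
  using graph_H unfolding ordered_graph_def by blast

lemma irrefl_H: "x \<in> {1..h} \<Longrightarrow> \<not> EH x x"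
  using graph_H unfolding ordered_graph_def by blast

lemma sym_G: "EG u v \<Longrightarrow> u \<in> {1..n} \<Longrightarrow> v \<in> {1..n} \<Longrightarrow> EG v u"
  using graph_G unfolding ordered_graph_def by blast

lemma irrefl_G: "v \<in> {1..n} \<Longrightarrow> \<not> EG v v"
  using graph_G unfolding ordered_graph_def by blast

abbreviation "sg \<equiv> seg EH"
abbreviation "K \<equiv> sg h"

definition sol :: "(nat \<Rightarrow> nat) \<Rightarrow> bool" where
  "sol g \<longleftrightarrow> ordered_hom n EG h EH g \<and> (\<forall>v\<in>{1..n}. low v \<le> g v \<and> g v \<le> up v)"

text \<open>For a map into \<open>{1..h}\<close> this determines the segment of every image. A
  bounded vector that decreases somewhere has no compatible solution, so the enumeration can run
  over all bounded vectors.\<close>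

definition compat :: "(nat \<Rightarrow> nat) \<Rightarrow> (nat \<Rightarrow> nat) \<Rightarrow> bool" where
  "compat d g \<longleftrightarrow> (\<forall>v\<in>{1..n}. \<forall>s\<in>{1..K}. v \<le> d s \<longleftrightarrow> sg (g v) < s)"

definition feasible :: "(nat \<Rightarrow> nat) \<Rightarrow> bool" where
  "feasible d \<longleftrightarrow> (\<exists>g. sol g \<and> compat d g)"

lemma yes_iff_sol: "hom_star_yes h EH n EG low up \<longleftrightarrow> (\<exists>g. sol g)"
  by (simp add: hom_star_yes_def sol_def)

lemma feasible_cong: "\<forall>s\<in>{1..K}. d s = d' s \<Longrightarrow> feasible d = feasible d'"
  by (auto simp: feasible_def compat_def)

lemma sol_mono: "sol g \<Longrightarrow> u \<in> {1..n} \<Longrightarrow> v \<in> {1..n} \<Longrightarrow> u \<le> v \<Longrightarrow> g u \<le> g v"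
  by (simp add: sol_def ordered_hom_def)

text \<open>The vertices mapped before a given segment form an initial part of \<open>G\<close>,
  since \<open>g\<close> and \<open>sg\<close> are both monotone; their maximum is the cut.\<close>

lemma ex_cut:
  assumes "sol g"
  shows "\<exists>d. (\<forall>s. d s \<le> n) \<and> feasible d"
proof -
  \<comment> \<open>The adjoined 0 is the cut when no vertex is mapped before segment
    \<open>s\<close>.\<close>
  let ?S = "\<lambda>s. insert 0 {v \<in> {1..n}. sg (g v) < s}"
  define d where "d s = Max (?S s)" for s
  have fin: "finite (?S s)" for s by simp
  have le: "d s \<le> n" for s unfolding d_def by (subst Max_le_iff) auto
  have "v \<le> d s \<longleftrightarrow> sg (g v) < s" if v: "v \<in> {1..n}" for v s
  proof
    assume "v \<le> d s"
    then obtain w where "w \<in> ?S s" "v \<le> w" unfolding d_def using Max_in[OF fin] by blast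
    then have w: "w \<in> {1..n}" "sg (g w) < s" "v \<le> w" using v by auto
    then show "sg (g v) < s" using seg_mono[of "g v" "g w" EH] sol_mono[OF assms v] by fastforce
  next
    assume "sg (g v) < s"
    then show "v \<le> d s" unfolding d_def using v by (intro Max_ge[OF fin]) auto
  qed
  then have "compat d g" by (simp add: compat_def)
  then show ?thesis using assms le feasible_def by blast
qed

lemma no_solution:
  assumes "\<And>d. \<forall>s\<in>{1..K}. d s \<le> n \<Longrightarrow> \<not> feasible d"
  shows "\<not> hom_star_yes h EH n EG low up"
  using assms ex_cut unfolding yes_iff_sol by blast

text \<open>What to do with a pair \<open>u\<close>, \<open>v\<close>: 0 means that no constraint is violated, 1 and 2 that
  \<open>f v\<close> respectively \<open>f u\<close> has to be increased, 3 that no solution compatible with \<open>d\<close> exists.\<close>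

definition act :: "(nat \<Rightarrow> nat) \<Rightarrow> (nat \<Rightarrow> nat) \<Rightarrow> nat \<Rightarrow> nat \<Rightarrow> nat" where
  "act d f u v =
    (if up v < f v then 3 else
     if v \<le> d (sg (f v)) then 3 else
     if d (Suc (sg (f v))) < v then 1 else
     if v \<le> u then 0 else
     if f v < f u then 1 else
     if \<not> EG v u then 0 else
     if f v \<le> f u then 1 else
     if EH (f u) (f v) then 0 else 2)"

text \<open>The pairs with \<open>u < v\<close> give monotonicity and edges, and diagonal pairs give
  the upper bounds. Edges in the other direction follow from the symmetry of both graphs.\<close>

lemma sol_if_act_zero:
  assumes act: "\<And>u v. u \<in> {1..n} \<Longrightarrow> v \<in> {1..n} \<Longrightarrow> act d f u v = 0"
    and low: "\<And>v. v \<in> {1..n} \<Longrightarrow> low v \<le> f v"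
  shows "sol f"
proof -
  have up: "f v \<le> up v" if "v \<in> {1..n}" for v
    using act[OF that that] by (auto simp: act_def split: if_splits)
  have range: "f v \<in> {1..h}" if "v \<in> {1..n}" for v
    using up[OF that] low[OF that] ranges[OF that] by simp
  have mono: "f u \<le> f v" if "u \<in> {1..n}" "v \<in> {1..n}" "u < v" for u v
    using act[OF that(1,2)] that(3) by (auto simp: act_def split: if_splits)
  have edge: "EH (f u) (f v)" if "u \<in> {1..n}" "v \<in> {1..n}" "u < v" "EG v u" for u v
    using act[OF that(1,2)] that(3,4) by (auto simp: act_def split: if_splits)
  have "EH (f u) (f v)" if uv: "u \<in> {1..n}" "v \<in> {1..n}" "EG u v" for u v
  proof -
    consider "u < v" | "u = v" | "v < u" by linarith
    then show ?thesis
    proof cases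
      case 1
      then show ?thesis using edge[OF uv(1,2)] uv sym_G by blast
    next
      case 2
      then show ?thesis using uv irrefl_G by blast
    next
      case 3
      then have "EH (f v) (f u)" using edge[OF uv(2,1)] uv(3) by blast
      then show ?thesis using sym_H range uv by blast
    qed
  qed
  moreover have "f u \<le> f v" if "u \<in> {1..n}" "v \<in> {1..n}" "u \<le> v" for u v
    using mono[OF that(1,2)] that(3) by (cases "u = v") auto
  ultimately show ?thesis using range low up by (simp add: sol_def ordered_hom_def)
qed

text \<open>Every increment is forced: a solution above \<open>f\<close> with the same cuts must be
  strictly larger at the vertex that is raised. This preserves \<open>f \<le> g\<close> throughout
  the search.\<close>

lemma act_sound:
  assumes g: "sol g" "compat d g" and last: "d (Suc K) = n + 1"
    and le: "\<And>v. v \<in> {1..n} \<Longrightarrow> f v \<le> g v" and low: "\<And>v. v \<in> {1..n} \<Longrightarrow> low v \<le> f v"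
    and u: "u \<in> {1..n}" and v: "v \<in> {1..n}"
  shows "act d f u v \<noteq> 3" and "act d f u v = 1 \<Longrightarrow> f v < g v" and "act d f u v = 2 \<Longrightarrow> f u < g u"
proof -
  have gv: "g v \<in> {1..h}" and gu: "g u \<in> {1..h}" and "g v \<le> up v"
    using g(1) u v by (auto simp: sol_def ordered_hom_def)
  have fu1: "1 \<le> f u" and fv1: "1 \<le> f v" using low[OF u] low[OF v] ranges[OF u] ranges[OF v] by auto
  have fg: "f v \<le> g v" "f u \<le> g u" using le u v by auto
  have sg_le: "sg (f v) \<le> sg (g v)" using fg(1) seg_mono by blast
  have sg_K: "sg (g v) \<le> K" using gv seg_mono by simp
  have lower: "\<not> v \<le> d (sg (f v))"
    using g(2) v sg_le sg_K seg_pos[of EH "f v"] unfolding compat_def by fastforce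
  show "act d f u v \<noteq> 3" using lower fg \<open>g v \<le> up v\<close> by (auto simp: act_def)
  \<comment> \<open>In the last segment the sentinel \<open>d (Suc K) = n + 1\<close> makes the
    right side false, matching the absence of a later segment.\<close>
  have upper: "sg (f v) < sg (g v) \<longleftrightarrow> d (Suc (sg (f v))) < v"
  proof (cases "sg (f v) = K")
    case True
    then show ?thesis using last v sg_K by simp
  next
    case False
    then have "Suc (sg (f v)) \<in> {1..K}" using sg_le sg_K by simp
    then have "v \<le> d (Suc (sg (f v))) \<longleftrightarrow> sg (g v) < Suc (sg (f v))"
      using g(2) v unfolding compat_def by blast
    then show ?thesis by auto
  qed
  have edge: "EH (g v) (g u)" if "EG v u"
    using g(1) u v that by (simp add: sol_def ordered_hom_def)
  have gmono: "g u \<le> g v" if "u < v" using sol_mono[OF g(1) u v] that by simp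
  show "f v < g v" if a: "act d f u v = 1"
  proof (rule ccontr)
    assume "\<not> f v < g v"
    then have eq: "f v = g v" using fg by simp
    then have "\<not> d (Suc (sg (f v))) < v" using upper by auto
    then have "u < v" "f v < f u \<or> EG v u \<and> f v \<le> f u"
      using a by (auto simp: act_def split: if_splits)
    moreover have "g u \<noteq> g v" if "EG v u"
      using edge[OF that] irrefl_H[OF gv] by metis
    ultimately show False using gmono fg eq by (cases "EG v u") auto
  qed
  show "f u < g u" if a: "act d f u v = 2"
  proof (rule ccontr)
    assume "\<not> f u < g u"
    then have eq: "f u = g u" using fg by simp
    have fuv: "\<not> d (Suc (sg (f v))) < v" "f u < f v" "EG v u" "\<not> EH (f u) (f v)"
      using a by (auto simp: act_def split: if_splits)
    then have "sg (f v) = sg (g v)" using upper sg_le by simp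
    then have start: "start EH (f v) = start EH (g v)" using start_eq_if_seg_eq fg(1) by blast
    \<comment> \<open>Were \<open>f u = g u\<close>, the edge at \<open>g v\<close> could be pulled
      down to \<open>f v\<close>, which lies in the same segment: by the shift property if
      \<open>f u\<close> is before that segment, by the clique property otherwise.\<close>
    have "EH (f v) (f u)"
    proof (cases "f u < start EH (f v)")
      case True
      then show ?thesis
        using segment_shifted[OF fv1 fg(1) start fu1] edge[OF fuv(3)] eq start by simp
    next
      case False
      then show ?thesis using segment_clique[of EH "f v" "f u"] fuv(2) by simp
    qed
    then show False using fuv(4) sym_H[of "f v" "f u"] fu1 fv1 fg gu gv by simp
  qed
qed

end

section \<open>The solver\<close>

abbreviation (input) "vL \<equiv> 0 :: nat"
abbreviation (input) "vh \<equiv> 19 :: nat"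
abbreviation (input) "vn \<equiv> 2 :: nat"
abbreviation (input) "vx \<equiv> 3 :: nat"
abbreviation (input) "vw \<equiv> 4 :: nat"
abbreviation (input) "va \<equiv> 5 :: nat"
abbreviation (input) "vK \<equiv> 6 :: nat"
abbreviation (input) "vrow \<equiv> 7 :: nat"
abbreviation (input) "vu \<equiv> 8 :: nat"
abbreviation (input) "vv \<equiv> 9 :: nat"
abbreviation (input) "vg \<equiv> 10 :: nat"
abbreviation (input) "vfail \<equiv> 11 :: nat"
abbreviation (input) "vt \<equiv> 12 :: nat"
abbreviation (input) "vi \<equiv> 13 :: nat"
abbreviation (input) "vres \<equiv> 14 :: nat"
abbreviation (input) "vgo \<equiv> 15 :: nat"
abbreviation (input) "vfv \<equiv> 16 :: nat"
abbreviation (input) "vfu \<equiv> 17 :: nat"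
abbreviation (input) "vs \<equiv> 18 :: nat"

abbreviation (input) "aIn \<equiv> 0 :: nat"
abbreviation (input) "aF \<equiv> 5 :: nat"
abbreviation (input) "aSeg \<equiv> 2 :: nat"
abbreviation (input) "aRow \<equiv> 3 :: nat"
abbreviation (input) "aD \<equiv> 4 :: nat"

abbreviation (input) incr :: "nat \<Rightarrow> com" where
  "incr x \<equiv> Asg x (V x \<oplus> N 1)"

text \<open>A truncated difference is nonzero iff \<open>vx \<le> vh\<close>. All order comparisons
  of the program are encoded in this way.\<close>

definition segment_guard :: aexp where
  "segment_guard = V vh \<oplus> N 1 \<ominus> V vx"

text \<open>The double loop over \<open>vx\<close> and \<open>vw\<close> is flattened to one
  adjacency test per round, which keeps the body loop-free. A failed test opens a segment and moves
  \<open>vw\<close> to \<open>vx\<close>. The row offset \<open>vrow\<close> is updated by addition,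
  as there is no multiplication.\<close>

definition segment_body :: com where
  "segment_body =
    Cond (V vx \<ominus> V vw)
      (Cond (V va \<ominus> V vw)
        (Cond (Arr aIn (V vrow \<oplus> V vw) \<ominus> Arr aIn (V vrow \<ominus> V vh \<oplus> V vw)) (Asg vt (N 0)) (Asg vt (N 1)))
        (Asg vt (Arr aIn (V vrow \<oplus> V vw))) ;;
       Cond (V vt) (incr vw) (incr vK ;; Asg va (V vx) ;; Asg vw (V vx)))
      (Wr aSeg (V vx) (V vK) ;; Wr aRow (V vx) (V vrow) ;; incr vx ;;
       Asg vrow (V vrow \<oplus> V vh) ;; Asg vw (N 1))"

definition segment_init :: com where
  "segment_init = Asg vh (Arr aIn (N 0)) ;; Asg vn (Arr aIn (N 1)) ;; Asg vx (N 1) ;; Asg vw (N 1) ;;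
     Asg va (N 1) ;; Asg vK (N 1) ;; Asg vrow (N 1)"

text \<open>Entry \<open>K + 1\<close> of the cut array is a sentinel larger than every vertex and
  every admissible cut. It closes the last segment and also stops the carry loop.\<close>

definition search_init :: com where
  "search_init = Wr aD (V vK \<oplus> N 1) (V vn \<oplus> N 1) ;; Asg vres (N 0) ;; Asg vgo (N 1)"

definition vertex_guard :: aexp where
  "vertex_guard = V vn \<oplus> N 1 \<ominus> V vv"

text \<open>The address of \<open>low\<close> is counted back from the end of the input, which
  avoids computing \<open>n * n\<close>.\<close>

definition reset_body :: com where
  "reset_body = Wr aF (V vv) (Arr aIn (V vL \<ominus> V vn \<ominus> V vn \<ominus> N 1 \<oplus> V vv)) ;; incr vv"

text \<open>\<open>vg\<close> is the address of the entry of \<open>G\<close> for the current pair;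
  it moves along its matrix in step with the scan.\<close>

definition scan_init :: com where
  "scan_init = Asg vu (N 1) ;; Asg vv (N 1) ;; Asg vg (V vrow \<oplus> N 1) ;; Asg vfail (N 0)"

definition decide :: com where
  "decide = Asg vfv (Arr aF (V vv)) ;; Asg vs (Arr aSeg (V vfv)) ;; Asg vfu (Arr aF (V vu)) ;;
    Cond (V vfv \<ominus> Arr aIn (V vL \<ominus> V vn \<ominus> N 1 \<oplus> V vv)) (Asg vt (N 3))
    (Cond (V vv \<ominus> Arr aD (V vs))
      (Cond (V vv \<ominus> Arr aD (V vs \<oplus> N 1)) (Asg vt (N 1))
      (Cond (V vv \<ominus> V vu)
        (Cond (V vfu \<ominus> V vfv) (Asg vt (N 1))
        (Cond (Arr aIn (V vg))
          (Cond (V vfv \<ominus> V vfu)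
            (Cond (Arr aIn (Arr aRow (V vfu) \<oplus> V vfv)) (Asg vt (N 0)) (Asg vt (N 2)))
            (Asg vt (N 1)))
          (Asg vt (N 0))))
        (Asg vt (N 0))))
      (Asg vt (N 3)))"

text \<open>An increment may spoil pairs already checked, so the scan restarts at the first pair.
  Failure sets \<open>vv\<close> beyond \<open>n\<close> to leave the loop.\<close>

definition apply_act :: com where
  "apply_act =
    Cond (V vt)
      (Cond (V vt \<ominus> N 2)
        (Asg vfail (N 1) ;; Asg vv (V vn \<oplus> N 1))
        (Cond (V vt \<ominus> N 1) (Asg vx (V vu)) (Asg vx (V vv)) ;;
         Wr aF (V vx) (Arr aF (V vx) \<oplus> N 1) ;; Asg vu (N 1) ;; Asg vv (N 1) ;; Asg vg (V vrow \<oplus> N 1)))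
      (incr vg ;; Cond (V vn \<ominus> V vu) (incr vu) (Asg vu (N 1) ;; incr vv))"

text \<open>The two truncated differences add up to the distance of the digit from \<open>n\<close>,
  so the guard is 1 iff the digit equals \<open>n\<close>.\<close>

definition carry_guard :: aexp where
  "carry_guard = N 1 \<ominus> ((V vn \<ominus> Arr aD (V vi)) \<oplus> (Arr aD (V vi) \<ominus> V vn))"

definition carry_body :: com where
  "carry_body = Wr aD (V vi) (N 0) ;; incr vi"

definition advance :: com where
  "advance = Asg vi (N 1) ;; While carry_guard carry_body ;;
     Cond (V vi \<ominus> V vK) (Asg vgo (N 0)) (Wr aD (V vi) (Arr aD (V vi) \<oplus> N 1))"

definition try_cut :: com where
  "try_cut = Asg vv (N 1) ;; While vertex_guard reset_body ;; scan_init ;;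
     While vertex_guard (decide ;; apply_act) ;;
     Cond (V vfail) advance (Asg vres (N 1) ;; Asg vgo (N 0))"

definition solver :: com where
  "solver = segment_init ;; While segment_guard segment_body ;; search_init ;; While (V vgo) try_cut"

lemma loop_free_solver [simp]:
  "loop_free segment_body" "loop_free segment_init" "loop_free search_init" "loop_free reset_body"
  "loop_free scan_init" "loop_free (decide ;; apply_act)" "loop_free carry_body"
  by (simp_all add: segment_body_def segment_init_def search_init_def reset_body_def scan_init_def
      decide_def apply_act_def carry_body_def)

lemma wf_solver [simp]:
  "wf_com segment_body" "wf_com segment_init" "wf_com search_init" "wf_com reset_body"
  "wf_com scan_init" "wf_com (decide ;; apply_act)" "wf_com carry_body"
  by (simp_all add: segment_body_def segment_init_def search_init_def reset_body_def scan_init_def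
      decide_def apply_act_def carry_body_def)

lemma wf_guards [simp]:
  "wf_exp segment_guard" "depth segment_guard \<le> 30" "wf_exp vertex_guard" "depth vertex_guard \<le> 30"
  "wf_exp carry_guard" "depth carry_guard \<le> 30"
  by (simp_all add: segment_guard_def vertex_guard_def carry_guard_def)

definition loop_cost :: "aexp \<Rightarrow> com \<Rightarrow> nat" where
  "loop_cost e c = cost c + length (tre e 30) + 3"

lemma exec2_While_loop_free:
  assumes "wf_exp e" and "depth e \<le> 30" and "loop_free c" and "wf_com c"
    and "\<And>\<sigma>. I \<sigma> \<Longrightarrow> val e \<sigma> \<noteq> 0 \<Longrightarrow> I (sem c \<sigma>) \<and> \<mu> (sem c \<sigma>) < (\<mu> \<sigma> :: nat)"
    and "I \<sigma>"
  shows "\<exists>\<sigma>'. exec2 (While e c) \<sigma> \<sigma>' ((\<mu> \<sigma> + 2) * loop_cost e c) \<and> I \<sigma>' \<and> val e \<sigma>' = 0"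
  unfolding loop_cost_def
  by (rule exec2_While) (use assms exec2_loop_free in blast)+

section \<open>Correctness of the solver on an input held in an array\<close>

locale hom_program = hom_instance +
  fixes L :: nat and inp :: "nat \<Rightarrow> nat"
  assumes L: "L = 2 + h * h + n * n + 2 * n"
    and inp_sizes: "inp 0 = h" "inp 1 = n"
    and inp_H: "\<And>x y. x \<in> {1..h} \<Longrightarrow> y \<in> {1..h} \<Longrightarrow> inp (1 + (x - 1) * h + y) = (if EH x y then 1 else 0)"
    and inp_G: "\<And>u v. u \<in> {1..n} \<Longrightarrow> v \<in> {1..n} \<Longrightarrow> inp (1 + h * h + (v - 1) * n + u) = (if EG v u then 1 else 0)"
    and inp_low: "\<And>v. v \<in> {1..n} \<Longrightarrow> inp (1 + h * h + n * n + v) = low v"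
    and inp_up: "\<And>v. v \<in> {1..n} \<Longrightarrow> inp (1 + h * h + n * n + n + v) = up v"
begin

definition header :: "state \<Rightarrow> bool" where
  "header \<sigma> \<longleftrightarrow> fst \<sigma> vL = L \<and> fst \<sigma> vh = h \<and> fst \<sigma> vn = n \<and> snd \<sigma> aIn = inp"

text \<open>Either \<open>x\<close> is still a candidate for the segment of \<open>x - 1\<close>,
  with the tests below \<open>w\<close> passed, or it has just opened its own segment. The zero
  array is the first cut vector.\<close>

definition segment_inv :: "state \<Rightarrow> bool" where
  "segment_inv \<sigma> \<longleftrightarrow> header \<sigma> \<and> (\<forall>i. snd \<sigma> aD i = 0) \<and>
    (let x = fst \<sigma> vx; w = fst \<sigma> vw; a = fst \<sigma> va; c = fst \<sigma> vK in
      1 \<le> x \<and> x \<le> h + 1 \<and> 1 \<le> w \<and> w \<le> x \<and> fst \<sigma> vrow = 1 + (x - 1) * h \<and>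
      (\<forall>y\<in>{1..<x}. snd \<sigma> aSeg y = sg y \<and> snd \<sigma> aRow y = 1 + (y - 1) * h) \<and>
      (a = start EH (x - 1) \<and> c = sg (x - 1) \<and> (\<forall>y\<in>{1..<w}. extends EH a x y) \<or>
       x \<le> h \<and> w = x \<and> a = start EH x \<and> c = sg x))"

text \<open>Lexicographic: advancing \<open>vx\<close> resets \<open>vw\<close> to 1, whose term is
  then \<open>h\<close>, below the weight \<open>h + 2\<close>.\<close>

definition segment_measure :: "state \<Rightarrow> nat" where
  "segment_measure \<sigma> = (h + 1 - fst \<sigma> vx) * (h + 2) + (h + 1 - fst \<sigma> vw)"

lemma segment_step:
  assumes I: "segment_inv \<sigma>" and g: "val segment_guard \<sigma> \<noteq> 0"
  shows "segment_inv (sem segment_body \<sigma>) \<and> segment_measure (sem segment_body \<sigma>) < segment_measure \<sigma>"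
proof -
  obtain s A where \<sigma>: "\<sigma> = (s, A)" by (cases \<sigma>)
  let ?x = "s vx" and ?w = "s vw" and ?a = "s va"
  have hd: "s vL = L" "s vh = h" "s vn = n" "A aIn = inp" and A4: "\<forall>i. A aD i = 0"
    and x: "1 \<le> ?x" and w: "1 \<le> ?w" "?w \<le> ?x" and row: "s vrow = 1 + (?x - 1) * h"
    and seg: "\<forall>y\<in>{1..<?x}. A aSeg y = sg y \<and> A aRow y = 1 + (y - 1) * h"
    and disj: "?a = start EH (?x - 1) \<and> s vK = sg (?x - 1) \<and> (\<forall>y\<in>{1..<?w}. extends EH ?a ?x y) \<or>
       ?x \<le> h \<and> ?w = ?x \<and> ?a = start EH ?x \<and> s vK = sg ?x"
    using I by (simp_all add: \<sigma> segment_inv_def header_def Let_def)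
  have xh: "?x \<le> h" using g hd by (simp add: \<sigma> segment_guard_def)
  obtain z where z: "?x = Suc z" using x by (cases ?x) auto
  show ?thesis
  proof (cases "?w < ?x")
    case True
    then have a: "?a = start EH z" "s vK = sg z" and ext: "\<forall>y\<in>{1..<?w}. extends EH ?a ?x y"
      using disj z by auto
    have "inp (s vrow + ?w) = (if EH ?x ?w then 1 else 0)"
      using inp_H[of ?x ?w] x w xh by (simp add: row)
    moreover have "inp (s vrow - h + ?w) = (if EH (?x - 1) ?w then 1 else 0)"
      using inp_H[of "?x - 1" ?w] x w xh True z by (cases z) (simp_all add: row)
    ultimately have sem: "sem segment_body (s, A) =
        (if extends EH ?a ?x ?w then (s(vt := 1, vw := ?w + 1), A)
         else (s(vt := 0, vK := s vK + 1, va := ?x, vw := ?x), A))"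
      using True hd by (simp add: segment_body_def extends_def)
    show ?thesis
    proof (cases "extends EH ?a ?x ?w")
      case True': True
      have "\<forall>y\<in>{1..<Suc ?w}. extends EH ?a ?x y" using ext True' by (auto simp: less_Suc_eq)
      then have "segment_inv (s(vt := 1, vw := ?w + 1), A)"
        using hd A4 x w row seg a xh True z by (simp add: segment_inv_def header_def)
      then show ?thesis using True' True w xh by (simp add: \<sigma> sem segment_measure_def)
    next
      case False
      then have "\<not> appendable EH (start EH z) ?x"
        using w True a by (auto simp: appendable_def)
      then have "start EH ?x = ?x" "sg ?x = s vK + 1" using z a by auto
      then have "segment_inv (s(vt := 0, vK := s vK + 1, va := ?x, vw := ?x), A)"
        using hd A4 x w row seg xh by (simp add: segment_inv_def header_def)
      then show ?thesis using False True w xh by (simp add: \<sigma> sem segment_measure_def)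
    qed
  next
    case False
    then have wx: "?w = ?x" using w by simp
    have "(\<forall>y\<in>{1..<?w}. extends EH ?a ?x y) \<longleftrightarrow> appendable EH ?a (Suc z)"
      using wx z by (simp add: appendable_def)
    then have new: "?a = start EH ?x" "s vK = sg ?x"
      using disj z by auto
    have sem: "sem segment_body (s, A) =
        (s(vx := ?x + 1, vrow := s vrow + h, vw := 1),
         A(aSeg := (A aSeg)(?x := s vK), aRow := (A aRow)(?x := s vrow)))"
      using wx hd by (simp add: segment_body_def)
    have "s vrow + h = 1 + ?x * h" using z row by simp
    then have "segment_inv (s(vx := ?x + 1, vrow := s vrow + h, vw := 1),
         A(aSeg := (A aSeg)(?x := s vK), aRow := (A aRow)(?x := s vrow)))"
      using hd A4 xh seg new row by (auto simp: segment_inv_def header_def less_Suc_eq)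
    moreover have "(h + 1 - (?x + 1)) * (h + 2) + h < (h + 1 - ?x) * (h + 2) + (h + 1 - ?w)"
    proof -
      obtain r where "h = ?x + r" using xh le_Suc_ex by blast
      then show ?thesis using wx by (simp add: algebra_simps)
    qed
    ultimately show ?thesis unfolding \<sigma> sem segment_measure_def by simp
  qed
qed

definition static :: "state \<Rightarrow> bool" where
  "static \<sigma> \<longleftrightarrow> header \<sigma> \<and> fst \<sigma> vK = K \<and> fst \<sigma> vrow = 1 + h * h \<and>
    (\<forall>y\<in>{1..h}. snd \<sigma> aSeg y = sg y \<and> snd \<sigma> aRow y = 1 + (y - 1) * h) \<and> snd \<sigma> aD (Suc K) = n + 1"

definition bounded :: "(nat \<Rightarrow> nat) \<Rightarrow> bool" where
  "bounded d \<longleftrightarrow> (\<forall>s\<in>{1..K}. d s \<le> n)"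

definition search_inv :: "state \<Rightarrow> bool" where
  "search_inv \<sigma> \<longleftrightarrow>
    (if fst \<sigma> vgo = 0 then fst \<sigma> vres = (if hom_star_yes h EH n EG low up then 1 else 0)
     else static \<sigma> \<and> bounded (snd \<sigma> aD) \<and> fst \<sigma> vres = 0 \<and>
       (\<forall>d. bounded d \<longrightarrow> num (n + 1) d K < num (n + 1) (snd \<sigma> aD) K \<longrightarrow> \<not> feasible d))"

lemma setup_correct:
  assumes "s vL = L" and "A aIn = inp" and "\<forall>i. A aD i = 0"
  shows "\<exists>\<sigma>1 \<sigma>2. exec2 segment_init (s, A) \<sigma>1 (cost segment_init) \<and>
    exec2 (While segment_guard segment_body) \<sigma>1 \<sigma>2 ((h * (h + 2) + h + 2) * loop_cost segment_guard segment_body) \<and>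
    exec2 search_init \<sigma>2 (sem search_init \<sigma>2) (cost search_init) \<and>
    search_inv (sem search_init \<sigma>2) \<and> num (n + 1) (snd (sem search_init \<sigma>2) aD) K = 0"
proof -
  let ?\<sigma>1 = "sem segment_init (s, A)"
  have sem: "?\<sigma>1 = (s(vh := h, vn := n, vx := 1, vw := 1, va := 1, vK := 1, vrow := 1), A)"
    using assms inp_sizes by (simp add: segment_init_def)
  have I: "segment_inv ?\<sigma>1"
    using assms by (simp add: sem segment_inv_def header_def)
  have \<mu>: "segment_measure ?\<sigma>1 = h * (h + 2) + h"
    by (simp add: sem segment_measure_def)
  have 1: "exec2 segment_init (s, A) ?\<sigma>1 (cost segment_init)"
    by (rule exec2_loop_free) auto
  obtain \<sigma>2 where \<sigma>2: "exec2 (While segment_guard segment_body) ?\<sigma>1 \<sigma>2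
      ((segment_measure ?\<sigma>1 + 2) * loop_cost segment_guard segment_body)"
      "segment_inv \<sigma>2" "val segment_guard \<sigma>2 = 0"
    using exec2_While_loop_free[of segment_guard segment_body segment_inv segment_measure ?\<sigma>1,
        OF wf_guards(1,2) loop_free_solver(1) wf_solver(1) segment_step I] by blast
  obtain s2 A2 where s2: "\<sigma>2 = (s2, A2)" by (cases \<sigma>2)
  have 3: "exec2 search_init \<sigma>2 (sem search_init \<sigma>2) (cost search_init)"
    by (rule exec2_loop_free) auto
  have x: "s2 vx = h + 1"
    using \<sigma>2(2,3) by (simp add: s2 segment_inv_def header_def segment_guard_def Let_def)
  \<comment> \<open>At \<open>vx = h + 1\<close> only the first disjunct of the invariant survives,
    so \<open>vK\<close> is \<open>K\<close>. The final \<open>vrow\<close> serves as the offset of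
    the matrix of \<open>G\<close>.\<close>
  then have seg: "header (s2, A2)" "\<forall>i. A2 aD i = 0" "s2 vK = K" "s2 vrow = 1 + h * h"
      "\<forall>y\<in>{1..h}. A2 aSeg y = sg y \<and> A2 aRow y = 1 + (y - 1) * h"
    using \<sigma>2(2) by (auto simp: s2 segment_inv_def Let_def)
  have sem2: "sem search_init (s2, A2) = (s2(vres := 0, vgo := 1), A2(aD := (A2 aD)(Suc K := n + 1)))"
    using seg by (simp add: search_init_def header_def)
  have num: "num (n + 1) ((A2 aD)(Suc K := n + 1)) K = 0"
    by (rule num_zero) (use seg in simp)
  have "search_inv (sem search_init \<sigma>2)"
    using seg num by (simp add: s2 sem2 search_inv_def static_def header_def bounded_def)
  moreover have "num (n + 1) (snd (sem search_init \<sigma>2) aD) K = 0" using num by (simp add: s2 sem2)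
  ultimately show ?thesis using 1 \<sigma>2(1)[unfolded \<mu>] 3 by blast
qed

section \<open>Pushing up from \<open>low\<close> for one cut vector\<close>

definition reset_inv :: "(nat \<Rightarrow> nat) \<Rightarrow> state \<Rightarrow> bool" where
  "reset_inv d \<sigma> \<longleftrightarrow> static \<sigma> \<and> snd \<sigma> aD = d \<and> fst \<sigma> vgo \<noteq> 0 \<and> fst \<sigma> vres = 0 \<and>
    1 \<le> fst \<sigma> vv \<and> fst \<sigma> vv \<le> n + 1 \<and> (\<forall>w\<in>{1..<fst \<sigma> vv}. snd \<sigma> aF w = low w)"

lemma reset_step:
  assumes I: "reset_inv d \<sigma>" and g: "val vertex_guard \<sigma> \<noteq> 0"
  shows "reset_inv d (sem reset_body \<sigma>) \<and> n + 1 - fst (sem reset_body \<sigma>) vv < n + 1 - fst \<sigma> vv"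
proof -
  obtain s A where \<sigma>: "\<sigma> = (s, A)" by (cases \<sigma>)
  have st: "s vL = L" "s vn = n" "A aIn = inp"
    using I by (simp_all add: \<sigma> reset_inv_def static_def header_def)
  have v: "s vv \<in> {1..n}"
    using I g st by (simp add: \<sigma> reset_inv_def vertex_guard_def)
  have "L - n - n - 1 + s vv = 1 + h * h + n * n + s vv" by (simp add: L)
  then have "sem reset_body (s, A) = (s(vv := s vv + 1), A(aF := (A aF)(s vv := low (s vv))))"
    using st inp_low[OF v] by (simp add: reset_body_def)
  moreover have "reset_inv d (s(vv := s vv + 1), A(aF := (A aF)(s vv := low (s vv))))"
    using I v by (auto simp: \<sigma> reset_inv_def static_def header_def less_Suc_eq)
  ultimately show ?thesis using v by (simp add: \<sigma> Suc_diff_le)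
qed

definition scan_inv :: "(nat \<Rightarrow> nat) \<Rightarrow> state \<Rightarrow> bool" where
  "scan_inv d \<sigma> \<longleftrightarrow> static \<sigma> \<and> snd \<sigma> aD = d \<and> fst \<sigma> vgo \<noteq> 0 \<and> fst \<sigma> vres = 0 \<and>
    (let f = snd \<sigma> aF; u = fst \<sigma> vu; v = fst \<sigma> vv in
      (\<forall>w\<in>{1..n}. low w \<le> f w \<and> f w \<le> h + 1) \<and>
      (\<forall>g. sol g \<longrightarrow> compat d g \<longrightarrow> (\<forall>w\<in>{1..n}. f w \<le> g w)) \<and>
      1 \<le> u \<and> 1 \<le> v \<and> v \<le> n + 1 \<and> (v \<le> n \<longrightarrow> u \<le> n \<and> fst \<sigma> vg = 1 + h * h + (v - 1) * n + u) \<and>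
      (fst \<sigma> vfail = 0 \<and> (\<forall>v'\<in>{1..n}. \<forall>u'\<in>{1..n}. v' < v \<or> v' = v \<and> u' < u \<longrightarrow> act d f u' v' = 0) \<or>
       fst \<sigma> vfail \<noteq> 0 \<and> v = n + 1 \<and> \<not> feasible d))"

text \<open>The position term is at most \<open>n * (n + 1) + n\<close>, which is below the weight
  \<open>(n + 1) * (n + 1)\<close>, so one unit of slack pays for a full restart of the
  scan.\<close>

definition scan_measure :: "state \<Rightarrow> nat" where
  "scan_measure \<sigma> = (\<Sum>v=1..n. h + 1 - snd \<sigma> aF v) * ((n + 1) * (n + 1)) +
     ((n + 1 - fst \<sigma> vv) * (n + 1) + (n + 1 - fst \<sigma> vu))"

text \<open>If \<open>f v\<close> exceeds \<open>up v\<close> it may be \<open>h + 1\<close>, where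
  the segment table is unspecified. The test against \<open>up\<close> comes first, so only the
  leftover value \<open>b\<close> of \<open>vs\<close> stays unknown.\<close>

lemma decide_correct:
  assumes st: "static (s, A)" and low: "\<And>w. w \<in> {1..n} \<Longrightarrow> low w \<le> A aF w"
    and u: "s vu \<in> {1..n}" and v: "s vv \<in> {1..n}" and vg: "s vg = 1 + h * h + (s vv - 1) * n + s vu"
  shows "\<exists>b. sem decide (s, A) = (s(vfv := A aF (s vv), vs := b, vfu := A aF (s vu),
    vt := act (A aD) (A aF) (s vu) (s vv)), A)"
proof -
  let ?fu = "A aF (s vu)" and ?fv = "A aF (s vv)"
  have hd: "s vL = L" "s vh = h" "s vn = n" "A aIn = inp"
    and seg: "\<And>y. y \<in> {1..h} \<Longrightarrow> A aSeg y = sg y" and row: "\<And>y. y \<in> {1..h} \<Longrightarrow> A aRow y = 1 + (y - 1) * h"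
    using st by (simp_all add: static_def header_def)
  have "L - n - 1 + s vv = 1 + h * h + n * n + n + s vv" by (simp add: L)
  then have up: "inp (L - n - 1 + s vv) = up (s vv)" using inp_up[OF v] by metis
  have g: "inp (s vg) = (if EG (s vv) (s vu) then 1 else 0)" using inp_G[OF u v] vg by simp
  have pos: "1 \<le> ?fu" "1 \<le> ?fv" using low[OF u] low[OF v] ranges[OF u] ranges[OF v] by auto
  show ?thesis
  proof (cases "up (s vv) < ?fv")
    case True
    then show ?thesis using hd up by (intro exI[of _ "A aSeg ?fv"]) (simp add: decide_def act_def)
  next
    case False
    then have fv: "?fv \<in> {1..h}" using pos ranges[OF v] by auto
    have e: "inp (A aRow ?fu + ?fv) = (if EH ?fu ?fv then 1 else 0)" if "?fu < ?fv"
    proof -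
      have "?fu \<in> {1..h}" using that fv pos by simp
      then show ?thesis using inp_H[of ?fu ?fv] fv row by simp
    qed
    show ?thesis using False hd up g e seg[OF fv]
      by (intro exI[of _ "A aSeg ?fv"]) (simp add: decide_def act_def)
  qed
qed

lemma sum_bump:
  fixes f :: "nat \<Rightarrow> nat"
  assumes "x \<in> {1..n}" and "f x \<le> h"
  shows "(\<Sum>v=1..n. h + 1 - (f(x := f x + 1)) v) < (\<Sum>v=1..n. h + 1 - f v)"
  by (rule sum_strict_mono_ex1) (use assms in auto)

lemma scan_bump:
  assumes I: "scan_inv d (s, A)" and fail: "s vfail = 0" and x: "x \<in> {1..n}" and fx: "A aF x \<le> h"
    and sound: "\<And>g. sol g \<Longrightarrow> compat d g \<Longrightarrow> A aF x < g x"
    and s': "s' vL = s vL" "s' vh = s vh" "s' vn = s vn" "s' vK = s vK" "s' vrow = s vrow"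
      "s' vgo = s vgo" "s' vres = s vres" "s' vfail = s vfail" "s' vu = 1" "s' vv = 1" "s' vg = 1 + h * h + 1"
  shows "scan_inv d (s', A(aF := (A aF)(x := A aF x + 1))) \<and>
    scan_measure (s', A(aF := (A aF)(x := A aF x + 1))) < scan_measure (s, A)"
proof
  let ?f = "(A aF)(x := A aF x + 1)"
  have le: "\<forall>w\<in>{1..n}. ?f w \<le> g w" if "sol g" "compat d g" for g
    using I sound[OF that] that by (auto simp: scan_inv_def Let_def Suc_le_eq)
  have "static (s, A)" "A aD = d" "s vgo \<noteq> 0" "s vres = 0"
    and f: "\<forall>w\<in>{1..n}. low w \<le> A aF w \<and> A aF w \<le> h + 1"
    using I by (simp_all add: scan_inv_def Let_def)
  moreover have "static (s', A(aF := ?f))"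
    using \<open>static (s, A)\<close> s' by (simp add: static_def header_def)
  moreover have "\<forall>w\<in>{1..n}. low w \<le> ?f w \<and> ?f w \<le> h + 1" using f fx by fastforce
  ultimately show "scan_inv d (s', A(aF := ?f))"
    using fail x le s' by (simp add: scan_inv_def Let_def)
  have "(\<Sum>v=1..n. h + 1 - ?f v) + 1 \<le> (\<Sum>v=1..n. h + 1 - A aF v)"
    using sum_bump[of x "A aF"] x fx by simp
  then have "((\<Sum>v=1..n. h + 1 - ?f v) + 1) * ((n + 1) * (n + 1))
      \<le> (\<Sum>v=1..n. h + 1 - A aF v) * ((n + 1) * (n + 1))"
    by (rule mult_le_mono1)
  then show "scan_measure (s', A(aF := ?f)) < scan_measure (s, A)"
    using s' by (simp add: scan_measure_def algebra_simps)
qed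

lemma scan_step:
  assumes I: "scan_inv d \<sigma>" and g: "val vertex_guard \<sigma> \<noteq> 0"
  shows "scan_inv d (sem (decide ;; apply_act) \<sigma>) \<and> scan_measure (sem (decide ;; apply_act) \<sigma>) < scan_measure \<sigma>"
proof -
  obtain s A where \<sigma>: "\<sigma> = (s, A)" by (cases \<sigma>)
  let ?f = "A aF" and ?u = "s vu" and ?v = "s vv"
  have st: "static (s, A)" and d: "A aD = d"
    and f: "\<forall>w\<in>{1..n}. low w \<le> ?f w \<and> ?f w \<le> h + 1"
    and sound: "\<forall>g. sol g \<longrightarrow> compat d g \<longrightarrow> (\<forall>w\<in>{1..n}. ?f w \<le> g w)"
    using I by (simp_all add: \<sigma> scan_inv_def Let_def)
  have n: "s vn = n" "s vrow = 1 + h * h" "d (Suc K) = n + 1"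
    using st d by (auto simp: static_def header_def)
  have uv: "?u \<in> {1..n}" "?v \<in> {1..n}" and vg: "s vg = 1 + h * h + (?v - 1) * n + ?u"
    and fail: "s vfail = 0"
    and scanned: "\<forall>v'\<in>{1..n}. \<forall>u'\<in>{1..n}. v' < ?v \<or> v' = ?v \<and> u' < ?u \<longrightarrow> act d ?f u' v' = 0"
    using I g n by (auto simp: \<sigma> scan_inv_def Let_def vertex_guard_def)
  have inv: "scan_inv d (s', A)"
    if "\<forall>x\<in>{vL, vh, vn, vK, vrow, vgo, vres}. s' x = s x" and "1 \<le> s' vu" "1 \<le> s' vv" "s' vv \<le> n + 1"
      and "s' vv \<le> n \<longrightarrow> s' vu \<le> n \<and> s' vg = 1 + h * h + (s' vv - 1) * n + s' vu"
      and "s' vfail = 0 \<and> (\<forall>v'\<in>{1..n}. \<forall>u'\<in>{1..n}. v' < s' vv \<or> v' = s' vv \<and> u' < s' vu \<longrightarrow> act d ?f u' v' = 0) \<or>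
       s' vfail \<noteq> 0 \<and> s' vv = n + 1 \<and> \<not> feasible d" for s'
  proof -
    have "static (s', A)" using st that(1) by (simp add: static_def header_def)
    moreover have "s' vgo \<noteq> 0" "s' vres = 0" using I that(1) by (simp_all add: \<sigma> scan_inv_def)
    ultimately show ?thesis
      unfolding scan_inv_def Let_def fst_conv snd_conv using d f sound that(2-) by blast
  qed
  let ?act = "act d ?f ?u ?v"
  obtain b where dec: "sem decide (s, A) = (s(vfv := ?f ?v, vs := b, vfu := ?f ?u, vt := ?act), A)"
    using decide_correct[OF st _ uv vg] f d by auto
  note snd = act_sound[where d = d and f = "?f" and u = "?u" and v = "?v", OF _ _ n(3)]
  have "?act \<in> {0, 1, 2, 3}" by (simp add: act_def)
  then consider "?act = 0" | "?act = 1" | "?act = 2" | "?act = 3" by auto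
  then show ?thesis
  proof cases
    case 1
    show ?thesis
    proof (cases "?u < n")
      case True
      then have sem: "sem (decide ;; apply_act) (s, A) =
          (s(vfv := ?f ?v, vs := b, vfu := ?f ?u, vt := 0, vg := s vg + 1, vu := ?u + 1), A)"
        using 1 n by (simp add: dec apply_act_def fun_upd_twist)
      have "\<forall>v'\<in>{1..n}. \<forall>u'\<in>{1..n}. v' < ?v \<or> v' = ?v \<and> u' < ?u + 1 \<longrightarrow> act d ?f u' v' = 0"
        using scanned 1 by (auto simp: less_Suc_eq)
      then have "scan_inv d (sem (decide ;; apply_act) (s, A))"
        unfolding sem by (intro inv) (use True vg fail uv in simp_all)
      moreover have "scan_measure (sem (decide ;; apply_act) (s, A)) < scan_measure (s, A)"
        unfolding sem using True by (simp add: scan_measure_def)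
      ultimately show ?thesis by (simp only: \<sigma>)
    next
      case False
      then have un: "?u = n" using uv by simp
      then have sem: "sem (decide ;; apply_act) (s, A) =
          (s(vfv := ?f ?v, vs := b, vfu := ?f ?u, vt := 0, vg := s vg + 1, vu := 1, vv := ?v + 1), A)"
        using 1 n by (simp add: dec apply_act_def fun_upd_twist)
      have "\<forall>v'\<in>{1..n}. \<forall>u'\<in>{1..n}. v' < ?v + 1 \<or> v' = ?v + 1 \<and> u' < 1 \<longrightarrow> act d ?f u' v' = 0"
      proof (intro ballI impI)
        fix v' u'
        assume vu': "v' \<in> {1..n}" "u' \<in> {1..n}" and "v' < ?v + 1 \<or> v' = ?v + 1 \<and> u' < 1"
        then have "v' < ?v \<or> v' = ?v \<and> u' < ?u \<or> v' = ?v \<and> u' = ?u" using un by auto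
        then show "act d ?f u' v' = 0" using scanned[rule_format, OF vu'] 1 by (elim disjE conjE) simp_all
      qed
      \<comment> \<open>The rows of the matrix are contiguous, so the same unit step also passes
        from the end of one row to the next.\<close>
      moreover have "s vg + 1 = 1 + h * h + (?v + 1 - 1) * n + 1"
        using vg uv un by (cases ?v) auto
      ultimately have "scan_inv d (sem (decide ;; apply_act) (s, A))"
        unfolding sem by (intro inv) (use fail uv in simp_all)
      moreover have "(n + 1 - (?v + 1)) * (n + 1) + n < (n + 1 - ?v) * (n + 1) + (n + 1 - ?u)"
        using uv un by (simp add: Suc_diff_le)
      then have "scan_measure (sem (decide ;; apply_act) (s, A)) < scan_measure (s, A)"
        unfolding sem by (simp add: scan_measure_def)
      ultimately show ?thesis by (simp only: \<sigma>)
    qed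
  next
    case 2
    have fv: "?f ?v \<le> h" using 2 ranges[OF uv(2)] by (auto simp: act_def split: if_splits)
    have sem: "sem (decide ;; apply_act) (s, A) =
        (s(vfv := ?f ?v, vs := b, vfu := ?f ?u, vt := 1, vx := ?v, vu := 1, vv := 1, vg := 1 + h * h + 1),
         A(aF := ?f(?v := ?f ?v + 1)))"
      using 2 n by (simp add: dec apply_act_def)
    show ?thesis unfolding \<sigma> sem
      by (rule scan_bump[OF I[unfolded \<sigma>] fail uv(2) fv]) (use snd(2) 2 sound f uv in auto)
  next
    case 3
    \<comment> \<open>Act 2 is reached only with \<open>f u < f v\<close> and
      \<open>f v \<le> up v\<close>.\<close>
    have fu: "?f ?u \<le> h" using 3 ranges[OF uv(2)] by (auto simp: act_def split: if_splits)
    have sem: "sem (decide ;; apply_act) (s, A) =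
        (s(vfv := ?f ?v, vs := b, vfu := ?f ?u, vt := 2, vx := ?u, vu := 1, vv := 1, vg := 1 + h * h + 1),
         A(aF := ?f(?u := ?f ?u + 1)))"
      using 3 n by (simp add: dec apply_act_def)
    show ?thesis unfolding \<sigma> sem
      by (rule scan_bump[OF I[unfolded \<sigma>] fail uv(1) fu]) (use snd(3) 3 sound f uv in auto)
  next
    case 4
    have sem: "sem (decide ;; apply_act) (s, A) =
        (s(vfv := ?f ?v, vs := b, vfu := ?f ?u, vt := 3, vfail := 1, vv := n + 1), A)"
      using 4 n by (simp add: dec apply_act_def)
    have "\<not> feasible d" using snd(1) 4 sound f uv by (auto simp: feasible_def)
    then have "scan_inv d (sem (decide ;; apply_act) (s, A))"
      unfolding sem by (intro inv) (use uv in simp_all)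
    moreover have "0 < (n + 1 - ?v) * (n + 1)" using uv by simp
    then have "scan_measure (sem (decide ;; apply_act) (s, A)) < scan_measure (s, A)"
      unfolding sem scan_measure_def by (simp del: mult_Suc_right)
    ultimately show ?thesis by (simp only: \<sigma>)
  qed
qed

section \<open>Counting through the cut vectors\<close>

definition carry_inv :: "(nat \<Rightarrow> nat) \<Rightarrow> state \<Rightarrow> bool" where
  "carry_inv d \<sigma> \<longleftrightarrow> static \<sigma> \<and> bounded (snd \<sigma> aD) \<and> fst \<sigma> vgo \<noteq> 0 \<and> fst \<sigma> vres = 0 \<and>
    1 \<le> fst \<sigma> vi \<and> fst \<sigma> vi \<le> K + 1 \<and>
    num (n + 1) (snd \<sigma> aD) K + (n + 1) ^ (fst \<sigma> vi - 1) = num (n + 1) d K + 1"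

text \<open>The invariant says that \<open>(n + 1) ^ (vi - 1)\<close> still has to be added to reach
  the successor. Resetting a digit \<open>n\<close> to 0 turns this into a carry one place
  higher.\<close>

lemma carry_step:
  assumes I: "carry_inv d \<sigma>" and g: "val carry_guard \<sigma> \<noteq> 0"
  shows "carry_inv d (sem carry_body \<sigma>) \<and> K + 1 - fst (sem carry_body \<sigma>) vi < K + 1 - fst \<sigma> vi"
proof -
  obtain s A where \<sigma>: "\<sigma> = (s, A)" by (cases \<sigma>)
  let ?i = "s vi" and ?d = "A aD"
  have di: "?d ?i = n"
    using I g by (auto simp: \<sigma> carry_inv_def static_def header_def carry_guard_def)
  moreover have "?d (Suc K) = n + 1" using I by (simp add: \<sigma> carry_inv_def static_def)
  \<comment> \<open>The sentinel digit is \<open>n + 1\<close>, hence never \<open>n\<close>, so the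
    loop cannot run past position \<open>K\<close>.\<close>
  ultimately have i: "?i \<in> {1..K}" using I by (cases "?i = Suc K") (auto simp: \<sigma> carry_inv_def)
  have sem: "sem carry_body (s, A) = (s(vi := ?i + 1), A(aD := ?d(?i := 0)))"
    by (simp add: carry_body_def)
  have "num (n + 1) (?d(?i := 0)) K + n * (n + 1) ^ (?i - 1) = num (n + 1) ?d K"
    using num_update[OF i, of "n + 1" ?d 0] di by simp
  moreover have "(n + 1) ^ ?i = (n + 1) ^ (?i - 1) + n * (n + 1) ^ (?i - 1)"
    using i by (cases ?i) auto
  ultimately have "num (n + 1) (?d(?i := 0)) K + (n + 1) ^ ?i = num (n + 1) d K + 1"
    using I by (simp add: \<sigma> carry_inv_def)
  then show ?thesis
    using I i by (auto simp: \<sigma> sem carry_inv_def static_def header_def bounded_def)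
qed

definition search_measure :: "state \<Rightarrow> nat" where
  "search_measure \<sigma> = (if fst \<sigma> vgo = 0 then 0 else (n + 1) ^ K - num (n + 1) (snd \<sigma> aD) K)"

lemma advance_correct:
  assumes I: "static \<sigma>" "bounded (snd \<sigma> aD)" "fst \<sigma> vgo \<noteq> 0" "fst \<sigma> vres = 0"
    and prev: "\<And>d. bounded d \<Longrightarrow> num (n + 1) d K \<le> num (n + 1) (snd \<sigma> aD) K \<Longrightarrow> \<not> feasible d"
  shows "\<exists>\<sigma>'. exec2 advance \<sigma> \<sigma>' (cost (Asg vi (N 1)) + ((K + 2) * loop_cost carry_guard carry_body +
      cost (Cond (V vi \<ominus> V vK) (Asg vgo (N 0)) (Wr aD (V vi) (Arr aD (V vi) \<oplus> N 1))))) \<and>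
    search_inv \<sigma>' \<and> search_measure \<sigma>' < (n + 1) ^ K - num (n + 1) (snd \<sigma> aD) K"
proof -
  let ?d = "snd \<sigma> aD"
  let ?fin = "Cond (V vi \<ominus> V vK) (Asg vgo (N 0)) (Wr aD (V vi) (Arr aD (V vi) \<oplus> N 1))"
  let ?\<sigma>1 = "sem (Asg vi (N 1)) \<sigma>"
  have 1: "exec2 (Asg vi (N 1)) \<sigma> ?\<sigma>1 (cost (Asg vi (N 1)))"
    by (rule exec2_loop_free) auto
  have I1: "carry_inv ?d ?\<sigma>1" and i1: "fst ?\<sigma>1 vi = 1"
    using I by (cases \<sigma>, simp add: carry_inv_def static_def header_def)+
  obtain \<sigma>2 where \<sigma>2: "exec2 (While carry_guard carry_body) ?\<sigma>1 \<sigma>2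
      ((K + 1 - fst ?\<sigma>1 vi + 2) * loop_cost carry_guard carry_body)"
      "carry_inv ?d \<sigma>2" "val carry_guard \<sigma>2 = 0"
    using exec2_While_loop_free[of carry_guard carry_body "carry_inv ?d" "\<lambda>\<sigma>. K + 1 - fst \<sigma> vi" ?\<sigma>1,
        OF wf_guards(5,6) loop_free_solver(7) wf_solver(7) carry_step I1] by blast
  obtain s A where s: "\<sigma>2 = (s, A)" by (cases \<sigma>2)
  let ?\<sigma>3 = "sem ?fin \<sigma>2"
  have 3: "exec2 ?fin \<sigma>2 ?\<sigma>3 (cost ?fin)"
    by (rule exec2_loop_free) auto
  have ex: "exec2 advance \<sigma> ?\<sigma>3 (cost (Asg vi (N 1)) + ((K + 2) * loop_cost carry_guard carry_body + cost ?fin))"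
    unfolding advance_def using exec2_Seq[OF 1 exec2_Seq[OF \<sigma>2(1) 3]] by (simp only: i1) simp
  have lt: "num (n + 1) ?d K < (n + 1) ^ K" using num_less I(2) by (simp add: bounded_def)
  have st: "static (s, A)" "bounded (A aD)" "s vgo \<noteq> 0" "s vres = 0"
    and i: "1 \<le> s vi" "s vi \<le> K + 1"
    and num: "num (n + 1) (A aD) K + (n + 1) ^ (s vi - 1) = num (n + 1) ?d K + 1"
    using \<sigma>2(2) by (simp_all add: s carry_inv_def)
  have vK: "s vK = K" using st by (simp add: static_def)
  show ?thesis
  proof (cases "s vi = K + 1")
    case True
    have sem: "?\<sigma>3 = (s(vgo := 0), A)" using True vK by (simp add: s)
    \<comment> \<open>Overflow means that the numeral was the largest one,
      \<open>(n + 1) ^ K - 1\<close>, so every bounded vector has been refuted.\<close>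
    have "\<not> feasible d" if "bounded d" for d
      using prev[OF that] num_less[of K d n] that num True by (simp add: bounded_def)
    then have "\<not> hom_star_yes h EH n EG low up" by (intro no_solution) (simp add: bounded_def)
    then have "search_inv ?\<sigma>3 \<and> search_measure ?\<sigma>3 < (n + 1) ^ K - num (n + 1) ?d K"
      unfolding sem search_inv_def search_measure_def using st lt by simp
    then show ?thesis using ex by blast
  next
    case False
    then have iK: "s vi \<in> {1..K}" using i by simp
    have sem: "?\<sigma>3 = (s, A(aD := (A aD)(s vi := A aD (s vi) + 1)))"
      using iK vK by (simp add: s)
    have "A aD (s vi) \<le> n" using st(2) iK by (simp add: bounded_def)
    moreover have "A aD (s vi) \<noteq> n"
      using \<sigma>2(3) st(1) by (auto simp: s carry_guard_def static_def header_def)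
    ultimately have b: "bounded ((A aD)(s vi := A aD (s vi) + 1))"
      using st(2) by (auto simp: bounded_def)
    have num': "num (n + 1) ((A aD)(s vi := A aD (s vi) + 1)) K = num (n + 1) ?d K + 1"
      using num_update[OF iK, of "n + 1" "A aD" "A aD (s vi) + 1"] num by simp
    have "search_inv ?\<sigma>3 \<and> search_measure ?\<sigma>3 < (n + 1) ^ K - num (n + 1) ?d K"
      unfolding sem search_inv_def search_measure_def
      using st b num' prev iK lt by (auto simp: static_def header_def less_Suc_eq_le)
    then show ?thesis using ex by blast
  qed
qed

section \<open>Assembly of the solver with its time bound\<close>

definition scan_bound :: nat where
  "scan_bound = n * (h + 1) * ((n + 1) * (n + 1)) + (n * (n + 1) + n)"

definition try_bound :: nat where
  "try_bound = cost (Asg vv (N 1)) + ((n + 2) * loop_cost vertex_guard reset_body + (cost scan_init +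
     ((scan_bound + 2) * loop_cost vertex_guard (decide ;; apply_act) +
      (length (tre (V vfail) 30) +
        (cost (Asg vi (N 1)) + ((K + 2) * loop_cost carry_guard carry_body +
          cost (Cond (V vi \<ominus> V vK) (Asg vgo (N 0)) (Wr aD (V vi) (Arr aD (V vi) \<oplus> N 1)))) +
         cost (Asg vres (N 1) ;; Asg vgo (N 0)) + 3)))))"

lemma try_cut_correct:
  assumes I: "search_inv \<sigma>" and g: "val (V vgo) \<sigma> \<noteq> 0"
  shows "\<exists>\<sigma>'. exec2 try_cut \<sigma> \<sigma>' try_bound \<and> search_inv \<sigma>' \<and> search_measure \<sigma>' < search_measure \<sigma>"
proof -
  obtain s A where \<sigma>: "\<sigma> = (s, A)" by (cases \<sigma>)
  let ?d = "A aD"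
  have go: "s vgo \<noteq> 0" using g by (simp add: \<sigma>)
  have st: "static (s, A)" "bounded ?d" "s vres = 0"
    and prev: "\<And>d. bounded d \<Longrightarrow> num (n + 1) d K < num (n + 1) ?d K \<Longrightarrow> \<not> feasible d"
    using I go by (auto simp: \<sigma> search_inv_def)
  have \<mu>: "search_measure \<sigma> = (n + 1) ^ K - num (n + 1) ?d K"
    using go by (simp add: \<sigma> search_measure_def)
  have lt: "num (n + 1) ?d K < (n + 1) ^ K" using num_less st(2) by (simp add: bounded_def)
  let ?\<sigma>1 = "sem (Asg vv (N 1)) \<sigma>"
  have 1: "exec2 (Asg vv (N 1)) \<sigma> ?\<sigma>1 (cost (Asg vv (N 1)))"
    by (rule exec2_loop_free) auto
  have I1: "reset_inv ?d ?\<sigma>1" and v1: "fst ?\<sigma>1 vv = 1"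
    using st go by (simp_all add: \<sigma> reset_inv_def static_def header_def)
  obtain \<sigma>2 where \<sigma>2: "exec2 (While vertex_guard reset_body) ?\<sigma>1 \<sigma>2
      ((n + 1 - fst ?\<sigma>1 vv + 2) * loop_cost vertex_guard reset_body)"
      "reset_inv ?d \<sigma>2" "val vertex_guard \<sigma>2 = 0"
    using exec2_While_loop_free[of vertex_guard reset_body "reset_inv ?d" "\<lambda>\<sigma>. n + 1 - fst \<sigma> vv" ?\<sigma>1,
        OF wf_guards(3,4) loop_free_solver(4) wf_solver(4) reset_step I1] by blast
  obtain s2 A2 where s2: "\<sigma>2 = (s2, A2)" by (cases \<sigma>2)
  let ?\<sigma>3 = "sem scan_init \<sigma>2"
  have 3: "exec2 scan_init \<sigma>2 ?\<sigma>3 (cost scan_init)"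
    by (rule exec2_loop_free) auto
  have st2: "static (s2, A2)" "A2 aD = ?d" "s2 vgo \<noteq> 0" "s2 vres = 0"
    using \<sigma>2(2) by (simp_all add: s2 reset_inv_def)
  have "s2 vv = n + 1" using \<sigma>2(2,3) st2(1)
    by (simp add: s2 reset_inv_def vertex_guard_def static_def header_def)
  then have low: "\<forall>w\<in>{1..n}. A2 aF w = low w" using \<sigma>2(2) by (auto simp: s2 reset_inv_def)
  have sem3: "?\<sigma>3 = (s2(vu := 1, vv := 1, vg := 1 + h * h + 1, vfail := 0), A2)"
    using st2 by (simp add: s2 scan_init_def static_def)
  have I3: "scan_inv ?d ?\<sigma>3"
    using st2 low ranges by (fastforce simp: sem3 scan_inv_def static_def header_def sol_def)
  have "(\<Sum>v=1..n. h + 1 - A2 aF v) \<le> n * (h + 1)"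
    using sum_bounded_above[of "{1..n}" "\<lambda>v. h + 1 - A2 aF v" "h + 1"] by simp
  then have "(\<Sum>v=1..n. h + 1 - A2 aF v) * ((n + 1) * (n + 1)) \<le> n * (h + 1) * ((n + 1) * (n + 1))"
    by (rule mult_le_mono1)
  then have \<mu>3: "scan_measure ?\<sigma>3 \<le> scan_bound"
    by (simp add: sem3 scan_measure_def scan_bound_def)
  obtain \<sigma>4 where \<sigma>4: "exec2 (While vertex_guard (decide ;; apply_act)) ?\<sigma>3 \<sigma>4
      ((scan_measure ?\<sigma>3 + 2) * loop_cost vertex_guard (decide ;; apply_act))"
      "scan_inv ?d \<sigma>4" "val vertex_guard \<sigma>4 = 0"
    using exec2_While_loop_free[of vertex_guard "decide ;; apply_act" "scan_inv ?d" scan_measure ?\<sigma>3,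
        OF wf_guards(3,4) loop_free_solver(6) wf_solver(6) scan_step I3] by blast
  have 4: "exec2 (While vertex_guard (decide ;; apply_act)) ?\<sigma>3 \<sigma>4
      ((scan_bound + 2) * loop_cost vertex_guard (decide ;; apply_act))"
    by (rule exec2_mono[OF \<sigma>4(1)]) (use \<mu>3 in simp)
  obtain s4 A4 where s4: "\<sigma>4 = (s4, A4)" by (cases \<sigma>4)
  have st4: "static \<sigma>4" "snd \<sigma>4 aD = ?d" "fst \<sigma>4 vgo \<noteq> 0" "fst \<sigma>4 vres = 0"
    using \<sigma>4(2) by (simp_all add: scan_inv_def)
  have v4: "s4 vv = n + 1"
    using \<sigma>4(2,3) by (simp add: s4 scan_inv_def vertex_guard_def static_def header_def Let_def)
  let ?Ta = "cost (Asg vi (N 1)) + ((K + 2) * loop_cost carry_guard carry_body +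
      cost (Cond (V vi \<ominus> V vK) (Asg vgo (N 0)) (Wr aD (V vi) (Arr aD (V vi) \<oplus> N 1))))"
  let ?succeed = "Asg vres (N 1) ;; Asg vgo (N 0)"
  have "\<exists>\<sigma>5. exec2 (Cond (V vfail) advance ?succeed) \<sigma>4 \<sigma>5
      (length (tre (V vfail) 30) + (?Ta + cost ?succeed + 3)) \<and> search_inv \<sigma>5 \<and>
      search_measure \<sigma>5 < (n + 1) ^ K - num (n + 1) ?d K"
  proof (cases "s4 vfail = 0")
    case True
    have "sol (A4 aF)"
      using \<sigma>4(2) True v4 by (intro sol_if_act_zero[of ?d]) (auto simp: s4 scan_inv_def Let_def)
    then have "hom_star_yes h EH n EG low up" using yes_iff_sol by blast
    then have I5: "search_inv (sem ?succeed \<sigma>4) \<and>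
        search_measure (sem ?succeed \<sigma>4) < (n + 1) ^ K - num (n + 1) ?d K"
      using lt by (simp add: s4 search_inv_def search_measure_def)
    have "exec2 ?succeed \<sigma>4 (sem ?succeed \<sigma>4) (cost ?succeed)" by (rule exec2_loop_free) auto
    then have "exec2 ?succeed \<sigma>4 (sem ?succeed \<sigma>4) (?Ta + cost ?succeed)" by (rule exec2_mono) simp
    then have "exec2 (Cond (V vfail) advance ?succeed) \<sigma>4 (sem ?succeed \<sigma>4)
        (length (tre (V vfail) 30) + (?Ta + cost ?succeed + 3))"
      using True by (intro exec2_If) (auto simp: s4)
    with I5 show ?thesis by blast
  next
    case False
    then have nf: "\<not> feasible ?d" using \<sigma>4(2) by (auto simp: s4 scan_inv_def Let_def)
    \<comment> \<open>Failure of the current vector extends to all bounded ones with the same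
      numeral, as they agree on \<open>{1..K}\<close>.\<close>
    have "\<not> feasible d" if "bounded d" "num (n + 1) d K \<le> num (n + 1) (snd \<sigma>4 aD) K" for d
    proof (cases "num (n + 1) d K = num (n + 1) ?d K")
      case True
      then show ?thesis
        using nf feasible_cong num_inj[of K d n ?d] that(1) st(2) by (auto simp: bounded_def)
    next
      case False
      then show ?thesis using prev that st4(2) by simp
    qed
    then obtain \<sigma>5 where \<sigma>5: "exec2 advance \<sigma>4 \<sigma>5 ?Ta" "search_inv \<sigma>5"
        "search_measure \<sigma>5 < (n + 1) ^ K - num (n + 1) (snd \<sigma>4 aD) K"
      using advance_correct[OF st4(1) _ st4(3,4)] st(2) st4(2) by auto
    have "exec2 advance \<sigma>4 \<sigma>5 (?Ta + cost ?succeed)" by (rule exec2_mono[OF \<sigma>5(1)]) simp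
    then have "exec2 (Cond (V vfail) advance ?succeed) \<sigma>4 \<sigma>5
        (length (tre (V vfail) 30) + (?Ta + cost ?succeed + 3))"
      using False by (intro exec2_If) (auto simp: s4)
    moreover have "search_measure \<sigma>5 < (n + 1) ^ K - num (n + 1) ?d K" using \<sigma>5(3) st4(2) by simp
    ultimately show ?thesis using \<sigma>5(2) by blast
  qed
  then obtain \<sigma>5 where \<sigma>5: "exec2 (Cond (V vfail) advance ?succeed) \<sigma>4 \<sigma>5
      (length (tre (V vfail) 30) + (?Ta + cost ?succeed + 3))" "search_inv \<sigma>5"
      "search_measure \<sigma>5 < search_measure \<sigma>"
    unfolding \<mu> by blast
  have "n + 1 - fst ?\<sigma>1 vv + 2 = n + 2" unfolding v1 by simp
  then have "exec2 try_cut \<sigma> \<sigma>5 try_bound"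
    unfolding try_cut_def try_bound_def
    using exec2_Seq[OF 1 exec2_Seq[OF \<sigma>2(1) exec2_Seq[OF 3 exec2_Seq[OF 4 \<sigma>5(1)]]]] by simp
  with \<sigma>5 show ?thesis by blast
qed

definition solver_bound :: nat where
  "solver_bound = cost segment_init + ((h * (h + 2) + h + 2) * loop_cost segment_guard segment_body +
     (cost search_init + ((n + 1) ^ K + 2) * (try_bound + length (tre (V vgo) 30) + 3)))"

lemma solver_correct:
  assumes "s vL = L" and "A aIn = inp" and "\<forall>i. A aD i = 0"
  shows "\<exists>\<sigma>'. exec2 solver (s, A) \<sigma>' solver_bound \<and>
    fst \<sigma>' vres = (if hom_star_yes h EH n EG low up then 1 else 0)"
proof -
  obtain \<sigma>1 \<sigma>2 where 1: "exec2 segment_init (s, A) \<sigma>1 (cost segment_init)"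
    and 2: "exec2 (While segment_guard segment_body) \<sigma>1 \<sigma>2
      ((h * (h + 2) + h + 2) * loop_cost segment_guard segment_body)"
    and 3: "exec2 search_init \<sigma>2 (sem search_init \<sigma>2) (cost search_init)"
    and I: "search_inv (sem search_init \<sigma>2)"
    and num: "num (n + 1) (snd (sem search_init \<sigma>2) aD) K = 0"
    using setup_correct[of s A, OF assms] by blast
  let ?\<sigma>3 = "sem search_init \<sigma>2"
  obtain \<sigma>4 where \<sigma>4: "exec2 (While (V vgo) try_cut) ?\<sigma>3 \<sigma>4
      ((search_measure ?\<sigma>3 + 2) * (try_bound + length (tre (V vgo) 30) + 3))"
      "search_inv \<sigma>4" "val (V vgo) \<sigma>4 = 0"
    using exec2_While[of "V vgo" search_inv try_cut try_bound search_measure ?\<sigma>3] try_cut_correct I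
    by auto
  have "search_measure ?\<sigma>3 \<le> (n + 1) ^ K" using num by (simp add: search_measure_def)
  then have 4: "exec2 (While (V vgo) try_cut) ?\<sigma>3 \<sigma>4
      (((n + 1) ^ K + 2) * (try_bound + length (tre (V vgo) 30) + 3))"
    by (intro exec2_mono[OF \<sigma>4(1)] mult_le_mono1) simp
  have "exec2 solver (s, A) \<sigma>4 solver_bound"
    unfolding solver_def solver_bound_def
    by (rule exec2_Seq[OF 1 exec2_Seq[OF 2 exec2_Seq[OF 3 4]]])
  moreover have "fst \<sigma>4 vres = (if hom_star_yes h EH n EG low up then 1 else 0)"
    using \<sigma>4(2,3) by (simp add: search_inv_def)
  ultimately show ?thesis by blast
qed

end

section \<open>Relocating the input and the final bound\<close>

lemma exec_BlockI:
  assumes "\<forall>i\<in>set cs. basic i" and "fold eff cs m = m'" and "length cs = T"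
  shows "exec (Block cs) m m' T"
  using exec_Block[OF assms(1), of m] assms(2,3) by simp

text \<open>Multiplication by repeated addition. Requiring register 2 to be 0 makes the clearing by
  the jump invisible, so the final memory is described exactly.\<close>

lemma exec_times_loop:
  assumes "m 4 = 1" and "m 2 = 0" and "r < 2"
  shows "exec (LWhile 3 (Block [Add 5 5 r, Sub 3 3 4])) m (m(5 := m 5 + m 3 * m r, 3 := 0)) ((m 3 + 1) * 5)"
  using assms
proof (induction "m 3" arbitrary: m)
  case 0
  then have "m(5 := m 5 + m 3 * m r, 3 := 0) = m" by (simp add: fun_upd_idem)
  then show ?case using exec_mono[OF exec_While_zero[of m 3]] 0 by simp
next
  case (Suc c)
  let ?m1 = "m(5 := m 5 + m r, 3 := c)"
  have fold: "fold eff [Add 5 5 r, Sub 3 3 4] m = ?m1"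
    using Suc.prems by (simp add: Suc.hyps(2)[symmetric])
  have 1: "exec (Block [Add 5 5 r, Sub 3 3 4]) m ?m1 2"
    by (rule exec_BlockI[OF _ fold]) simp_all
  have junk: "?m1(2 := 0) = ?m1" using Suc.prems by (simp add: fun_upd_idem)
  have "exec (LWhile 3 (Block [Add 5 5 r, Sub 3 3 4])) ?m1
      (?m1(5 := ?m1 5 + ?m1 3 * ?m1 r, 3 := 0)) ((?m1 3 + 1) * 5)"
    by (rule Suc.hyps(1)) (use Suc.prems in simp_all)
  moreover have "?m1(5 := ?m1 5 + ?m1 3 * ?m1 r, 3 := 0) = m(5 := m 5 + m 3 * m r, 3 := 0)"
    using Suc.hyps(2)[symmetric] Suc.prems by (auto simp: fun_eq_iff)
  ultimately have 2: "exec (LWhile 3 (Block [Add 5 5 r, Sub 3 3 4])) (?m1(2 := 0))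
      (m(5 := m 5 + m 3 * m r, 3 := 0)) ((c + 1) * 5)"
    unfolding junk by simp
  show ?case
    using exec_While_nonzero[OF _ 1 2] Suc.hyps(2)[symmetric] by simp
qed

text \<open>Register 1 is the source index, register 3 the target address with stride 8, register 0
  the remaining count and register 4 the constant 1.\<close>

definition copy_body :: "instr list" where
  "copy_body = [Load 2 1, Store 3 2, Add 1 1 4, LoadC 2 8, Add 3 3 2, Sub 0 0 4]"

text \<open>Copying starts at cell 6, as lower cells are placed by hand. For
  \<open>L \<le> 6\<close> the truncated count is 0, and cells from \<open>L\<close> on are 0 in the
  source as well.\<close>

definition copy_inv :: "nat \<Rightarrow> mem \<Rightarrow> mem \<Rightarrow> bool" where
  "copy_inv L inp m \<longleftrightarrow> m 4 = 1 \<and> m 5 = L + 64 \<and> 6 \<le> m 1 \<and> m 0 = L - m 1 \<and> m 3 = L + 64 + 8 * m 1 \<and>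
    (\<forall>j. 6 \<le> j \<longrightarrow> j < L \<longrightarrow> m j = inp j) \<and>
    (\<forall>i. m (L + 64 + 8 * i) = (if i < m 1 then inp i else 0)) \<and>
    (\<forall>i k. 1 \<le> k \<longrightarrow> k < 8 \<longrightarrow> m (L + 64 + 8 * i + k) = 0)"

lemma copy_step:
  assumes I: "copy_inv L inp m" and "m 0 \<noteq> 0"
  shows "\<exists>m1. exec (Block copy_body) m m1 6 \<and> copy_inv L inp (m1(2 := 0)) \<and> (m1(2 := 0)) 0 < m 0"
proof -
  have regs: "m 4 = 1" "m 5 = L + 64" "6 \<le> m 1" "m 0 = L - m 1" "m 3 = L + 64 + 8 * m 1"
    and src: "\<And>j. 6 \<le> j \<Longrightarrow> j < L \<Longrightarrow> m j = inp j"
    and dst: "\<And>i. m (L + 64 + 8 * i) = (if i < m 1 then inp i else 0)"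
    and gap: "\<And>i k. 1 \<le> k \<Longrightarrow> k < 8 \<Longrightarrow> m (L + 64 + 8 * i + k) = 0"
    using I by (simp_all add: copy_inv_def)
  have lt: "m 1 < L" using assms(2) regs by simp
  let ?m1 = "m(L + 64 + 8 * m 1 := inp (m 1), 1 := m 1 + 1, 2 := 8, 3 := m 3 + 8, 0 := m 0 - 1)"
  have fold: "fold eff copy_body m = ?m1"
    using regs src[OF regs(3) lt] lt by (simp add: copy_body_def fun_eq_iff)
  have "exec (Block copy_body) m ?m1 6"
    by (rule exec_BlockI[OF _ fold]) (simp_all add: copy_body_def)
  moreover have "copy_inv L inp (?m1(2 := 0))"
    unfolding copy_inv_def
  proof (intro conjI allI impI)
    fix i k :: nat
    assume k: "1 \<le> k" "k < 8"
    have "8 * i + k \<noteq> 8 * m 1" using k interleave_inj[of k 0 i "m 1"] by simp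
    then show "(?m1(2 := 0)) (L + 64 + 8 * i + k) = 0" using gap[OF k] by simp
  qed (use regs src dst lt in \<open>auto simp: less_Suc_eq\<close>)
  ultimately show ?thesis using assms(2) by (intro exI[of _ ?m1]) simp
qed

text \<open>The input occupies the low registers from the start. Cell 2 holds a diagonal entry and is
  therefore 0; cells 3, 4 and 5 hold bits (for \<open>h \<le> 1\<close> also the bounds stored there are at most 1), so branching on them frees these registers while
  the bits are remembered in the control state.\<close>

definition relocate :: "nat \<Rightarrow> nat \<Rightarrow> nat \<Rightarrow> lcom" where
  "relocate b3 b4 b5 =
    LSeq (Block [LoadC 4 1, LoadC 5 0, LoadC 2 0, Add 3 0 2])
    (LSeq (LWhile 3 (Block [Add 5 5 0, Sub 3 3 4]))
    (LSeq (Block [LoadC 2 0, Add 3 1 2])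
    (LSeq (LWhile 3 (Block [Add 5 5 1, Sub 3 3 4]))
    (LSeq (Block [Add 5 5 1, Add 5 5 1, LoadC 3 66, Add 5 5 3, Store 5 0,
       LoadC 0 8, Add 3 5 0, Store 3 1, Add 3 3 0,
       LoadC 1 b3, Add 3 3 0, Store 3 1, LoadC 1 b4, Add 3 3 0, Store 3 1,
       LoadC 1 b5, Add 3 3 0, Store 3 1, Add 3 3 0, LoadC 1 6, LoadC 2 70, Sub 0 5 2])
    (LSeq (LWhile 0 (Block copy_body)) (Block [LoadC 2 64, Sub 6 5 2]))))))"

definition relocate_bound :: "nat \<Rightarrow> nat \<Rightarrow> nat" where
  "relocate_bound h n = 4 + ((h + 1) * 5 + (2 + ((n + 1) * 5 + (22 + ((2 + h * h + n * n + 2 * n + 1) * 9 + 2)))))"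

lemma relocate_correct:
  assumes m: "m 0 = h" "m 1 = n" "m 2 = 0" and L: "L = 2 + h * h + n * n + 2 * n"
    and zero: "\<And>i. L \<le> i \<Longrightarrow> m i = 0"
  shows "\<exists>m' s. exec (relocate (m 3) (m 4) (m 5)) m m' (relocate_bound h n) \<and>
    s vL = L \<and> rel (L + 64) (s, \<lambda>k. if k = 0 then m else (\<lambda>i. 0)) m'"
proof -
  let ?b1 = "[LoadC 4 1, LoadC 5 0, LoadC 2 0, Add 3 0 2]"
  let ?m1 = "m(4 := 1, 5 := 0, 2 := 0, 3 := h)"
  have f1: "fold eff ?b1 m = ?m1" using m by simp
  have e1: "exec (Block ?b1) m ?m1 4" by (rule exec_BlockI[OF _ f1]) simp_all
  let ?m2 = "?m1(5 := h * h, 3 := 0)"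
  have e2: "exec (LWhile 3 (Block [Add 5 5 0, Sub 3 3 4])) ?m1 ?m2 ((h + 1) * 5)"
    using exec_times_loop[of ?m1 0] m by simp
  let ?b3 = "[LoadC 2 0, Add 3 1 2]"
  let ?m3 = "?m2(2 := 0, 3 := n)"
  have f3: "fold eff ?b3 ?m2 = ?m3" using m by simp
  have e3: "exec (Block ?b3) ?m2 ?m3 2" by (rule exec_BlockI[OF _ f3]) simp_all
  let ?m4 = "?m3(5 := h * h + n * n, 3 := 0)"
  have e4: "exec (LWhile 3 (Block [Add 5 5 1, Sub 3 3 4])) ?m3 ?m4 ((n + 1) * 5)"
    using exec_times_loop[of ?m3 1] m by simp
  \<comment> \<open>The constant 66 is the 2 in \<open>L\<close> plus 64 reserved registers, and 70
    is \<open>64 + 6\<close>, leaving \<open>L - 6\<close> cells to copy. Target slot 2 is skipped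
    because it must hold 0 and already does.\<close>
  let ?b5 = "[Add 5 5 1, Add 5 5 1, LoadC 3 66, Add 5 5 3, Store 5 0,
       LoadC 0 8, Add 3 5 0, Store 3 1, Add 3 3 0,
       LoadC 1 (m 3), Add 3 3 0, Store 3 1, LoadC 1 (m 4), Add 3 3 0, Store 3 1,
       LoadC 1 (m 5), Add 3 3 0, Store 3 1, Add 3 3 0, LoadC 1 6, LoadC 2 70, Sub 0 5 2]"
  let ?B = "L + 64"
  let ?m5 = "m(4 := 1, 5 := ?B, 3 := ?B + 48, 1 := 6, 2 := 70, 0 := L - 6,
    ?B := h, ?B + 8 := n, ?B + 24 := m 3, ?B + 32 := m 4, ?B + 40 := m 5)"
  have B: "h * h + n * n + n + n + 66 = ?B" by (simp add: L)
  have f5: "fold eff ?b5 ?m4 = ?m5"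
    using m B by (simp add: fun_eq_iff)
  have e5: "exec (Block ?b5) ?m4 ?m5 22" by (rule exec_BlockI[OF _ f5]) simp_all
  have I5: "copy_inv L m ?m5"
    unfolding copy_inv_def
  proof (intro conjI allI impI)
    fix i :: nat
    consider "i = 0" | "i = 1" | "i = 2" | "i = 3" | "i = 4" | "i = 5" | "6 \<le> i" by linarith
    then show "?m5 (?B + 8 * i) = (if i < ?m5 1 then m i else 0)"
      by cases (use m zero in auto)
  next
    fix i k :: nat
    assume k: "1 \<le> k" "k < 8"
    have "8 * i + k \<noteq> 8 * j" for j using k interleave_inj[of k 0 i j] by simp
    from this[of 0] this[of 1] this[of 3] this[of 4] this[of 5]
    show "?m5 (?B + 8 * i + k) = 0" using zero k by simp
  qed (use zero in auto)
  obtain m6 where e6: "exec (LWhile 0 (Block copy_body)) ?m5 m6 ((?m5 0 + 1) * (6 + 3))"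
    and I6: "copy_inv L m m6" and m60: "m6 0 = 0"
    using exec_While[of "copy_inv L m" 0 "Block copy_body" 6 "\<lambda>m. m 0", OF copy_step I5] by blast
  have e6': "exec (LWhile 0 (Block copy_body)) ?m5 m6 ((2 + h * h + n * n + 2 * n + 1) * 9)"
    by (rule exec_mono[OF e6]) (simp add: L)
  \<comment> \<open>Register 6 is variable \<open>vL\<close>, so the solver starts with the input
    length.\<close>
  let ?b7 = "[LoadC 2 64, Sub 6 5 2]"
  let ?m7 = "m6(2 := 64, 6 := L)"
  have f7: "fold eff ?b7 m6 = ?m7" using I6 by (simp add: copy_inv_def)
  have e7: "exec (Block ?b7) m6 ?m7 2" by (rule exec_BlockI[OF _ f7]) simp_all
  have "exec (relocate (m 3) (m 4) (m 5)) m ?m7 (relocate_bound h n)"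
    unfolding relocate_def relocate_bound_def
    by (intro exec_Seq[OF e1] exec_Seq[OF e2] exec_Seq[OF e3] exec_Seq[OF e4] exec_Seq[OF e5]
        exec_Seq[OF e6'] e7)
  moreover have "rel ?B (\<lambda>x. ?m7 (6 + x), \<lambda>k. if k = 0 then m else (\<lambda>i. 0)) ?m7"
    unfolding rel_def
  proof (intro conjI allI impI)
    fix k i :: nat
    assume "k < 8"
    have "L \<le> m6 1" and "\<forall>i. m6 (?B + 8 * i) = (if i < m6 1 then m i else 0)"
      and gap: "\<forall>i k. 1 \<le> k \<longrightarrow> k < 8 \<longrightarrow> m6 (?B + 8 * i + k) = 0"
      using I6 m60 by (simp_all add: copy_inv_def)
    then have "m6 (?B + 8 * i) = m i" using zero by simp
    then show "?m7 (?B + 8 * i + k) = snd (\<lambda>x. ?m7 (6 + x), \<lambda>k. if k = 0 then m else (\<lambda>i. 0)) k i"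
      using gap \<open>k < 8\<close> by (cases "k = 0") simp_all
  qed (use I6 in \<open>simp_all add: copy_inv_def\<close>)
  ultimately show ?thesis by (intro exI[of _ ?m7] exI[of _ "\<lambda>x. ?m7 (6 + x)"]) simp
qed

definition dispatch :: lcom where
  "dispatch = LIf 3
    (LIf 4 (LIf 5 (relocate 1 1 1) (relocate 1 1 0)) (LIf 5 (relocate 1 0 1) (relocate 1 0 0)))
    (LIf 4 (LIf 5 (relocate 0 1 1) (relocate 0 1 0)) (LIf 5 (relocate 0 0 1) (relocate 0 0 0)))"

lemma exec_If_rel:
  assumes "m r \<noteq> 0 \<Longrightarrow> \<exists>m'. exec c1 m m' T \<and> rel B \<sigma> m'" and "m r = 0 \<Longrightarrow> \<exists>m'. exec c2 m m' T \<and> rel B \<sigma> m'"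
  shows "\<exists>m'. exec (LIf r c1 c2) m m' (T + 3) \<and> rel B \<sigma> m'"
proof (cases "m r = 0")
  case True
  with assms(2) obtain m' where "exec c2 m m' T" "rel B \<sigma> m'" by blast
  then show ?thesis using exec_If_zero[where m = m and r = r, OF True] by blast
next
  case False
  with assms(1) obtain m' where "exec c1 m m' T" "rel B \<sigma> m'" by blast
  then show ?thesis using exec_If_nonzero[where m = m and r = r, OF False] rel_upd2 by blast
qed

lemma dispatch_correct:
  assumes m: "m 0 = h" "m 1 = n" "m 2 = 0" and L: "L = 2 + h * h + n * n + 2 * n"
    and zero: "\<And>i. L \<le> i \<Longrightarrow> m i = 0" and bits: "m 3 \<le> 1" "m 4 \<le> 1" "m 5 \<le> 1"
  shows "\<exists>m' s. exec dispatch m m' (relocate_bound h n + 3 + 3 + 3) \<and>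
    s vL = L \<and> rel (L + 64) (s, \<lambda>k. if k = 0 then m else (\<lambda>i. 0)) m'"
proof -
  obtain s m' where s: "s vL = L"
    and m': "exec (relocate (m 3) (m 4) (m 5)) m m' (relocate_bound h n)"
      "rel (L + 64) (s, \<lambda>k. if k = 0 then m else (\<lambda>i. 0)) m'"
    using relocate_correct[OF m L zero] by blast
  have one: "m r = 1" if "m r \<le> 1" "m r \<noteq> 0" for r using that by simp
  have "\<exists>m'. exec dispatch m m' (relocate_bound h n + 3 + 3 + 3) \<and>
      rel (L + 64) (s, \<lambda>k. if k = 0 then m else (\<lambda>i. 0)) m'"
    unfolding dispatch_def
    by (intro exec_If_rel exI[of _ m']; use m' one[OF bits(1)] one[OF bits(2)] one[OF bits(3)] in simp)
  with s show ?thesis by blast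
qed

section \<open>Reading the encoded instance from the initial memory\<close>

lemma length_matrix: "length (concat (map (\<lambda>u. map (f u) ys) zs)) = length zs * length ys"
  by (induction zs) auto

lemma nth_matrix:
  assumes "i < length zs" and "j < length ys"
  shows "concat (map (\<lambda>u. map (f u) ys) zs) ! (i * length ys + j) = f (zs ! i) (ys ! j)"
  using assms(1)
proof (induction zs arbitrary: i)
  case (Cons z zs)
  then show ?case using assms(2) by (cases i) (simp_all add: nth_append)
qed simp

definition initial :: "nat list \<Rightarrow> mem" where
  "initial xs = (\<lambda>i. if i < length xs then xs ! i else 0)"

context hom_instance
begin

definition matrix_H :: "nat list" where
  "matrix_H = concat (map (\<lambda>u. map (\<lambda>v. if EH u v then 1 else 0) [1..<h + 1]) [1..<h + 1])"
definition matrix_G :: "nat list" where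
  "matrix_G = concat (map (\<lambda>u. map (\<lambda>v. if EG u v then 1 else 0) [1..<n + 1]) [1..<n + 1])"

abbreviation (input) "xs \<equiv> encode h EH n EG low up"

lemma encode_eq: "xs = [h, n] @ matrix_H @ matrix_G @ map low [1..<n + 1] @ map up [1..<n + 1]"
  by (simp add: encode_def matrix_H_def matrix_G_def)

lemma lengths: "length matrix_H = h * h" "length matrix_G = n * n"
  unfolding matrix_H_def matrix_G_def length_matrix by simp_all

lemma nth_matrix_H: "i < h \<Longrightarrow> j < h \<Longrightarrow> matrix_H ! (i * h + j) = (if EH (Suc i) (Suc j) then 1 else 0)"
  unfolding matrix_H_def
  using nth_matrix[of i "[1..<h + 1]" j "[1..<h + 1]" "\<lambda>u v. if EH u v then 1 else 0 :: nat"]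
  by (simp del: upt_Suc)

lemma nth_matrix_G: "i < n \<Longrightarrow> j < n \<Longrightarrow> matrix_G ! (i * n + j) = (if EG (Suc i) (Suc j) then 1 else 0)"
  unfolding matrix_G_def
  using nth_matrix[of i "[1..<n + 1]" j "[1..<n + 1]" "\<lambda>u v. if EG u v then 1 else 0 :: nat"]
  by (simp del: upt_Suc)

lemma length_encode: "length xs = 2 + h * h + n * n + 2 * n"
  by (simp add: encode_eq lengths)

lemma encode_program: "hom_program h n EH EG low up (length xs) (initial xs)"
proof
  show "length xs = 2 + h * h + n * n + 2 * n" by (rule length_encode)
  show "initial xs 0 = h" "initial xs 1 = n"
    by (simp_all add: initial_def length_encode) (simp_all add: encode_eq)
next
  fix x y assume xy: "x \<in> {1..h}" "y \<in> {1..h}"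
  obtain i j where ij: "x = Suc i" "y = Suc j" using xy by (cases x; cases y) auto
  have lt: "i * h + j < h * h" using xy ij mult_le_mono1[of "Suc i" h h] by simp
  have "xs ! (2 + (i * h + j)) = (if EH x y then 1 else 0)"
    using xy ij lt nth_matrix_H[of i j] by (simp add: encode_eq nth_append lengths del: upt_Suc)
  then show "initial xs (1 + (x - 1) * h + y) = (if EH x y then 1 else 0)"
    using lt ij by (simp add: initial_def length_encode)
next
  fix u v assume uv: "u \<in> {1..n}" "v \<in> {1..n}"
  obtain i j where ij: "v = Suc i" "u = Suc j" using uv by (cases u; cases v) auto
  have lt: "i * n + j < n * n" using uv ij mult_le_mono1[of "Suc i" n n] by simp
  have "xs ! (2 + (h * h + (i * n + j))) = (if EG v u then 1 else 0)"
    using uv ij lt nth_matrix_G[of i j] by (simp add: encode_eq nth_append lengths del: upt_Suc)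
  then show "initial xs (1 + h * h + (v - 1) * n + u) = (if EG v u then 1 else 0)"
    using lt ij by (simp add: initial_def length_encode add.assoc)
next
  fix v assume v: "v \<in> {1..n}"
  then obtain i where i: "v = Suc i" "i < n" by (cases v) auto
  have "xs ! (2 + (h * h + (n * n + i))) = low v" "xs ! (2 + (h * h + (n * n + (n + i)))) = up v"
    using i by (simp_all add: encode_eq nth_append lengths del: upt_Suc)
  then show "initial xs (1 + h * h + n * n + v) = low v" "initial xs (1 + h * h + n * n + n + v) = up v"
    using i by (simp_all add: initial_def length_encode add.assoc)
qed

lemma h_zero: "h = 0 \<Longrightarrow> n = 0"
  using ranges[of 1] by (cases n) auto

lemma initial_cell2: "initial xs 2 = 0"
proof (cases "h = 0")
  case True
  then have "length xs = 2" using h_zero length_encode by simp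
  then show ?thesis by (simp add: initial_def)
next
  case False
  then have "initial xs (1 + (1 - 1) * h + 1) = (if EH 1 1 then 1 else 0)"
    by (intro hom_program.inp_H[OF encode_program]) auto
  then show ?thesis using irrefl_H[of 1] False by (simp add: numeral_2_eq_2)
qed

text \<open>For \<open>2 \<le> h\<close> the matrix of \<open>H\<close> has at least four entries
  and fills cells 2 to 5. Otherwise the bounds \<open>low\<close> and \<open>up\<close> are
  themselves at most 1.\<close>

lemma initial_bit:
  assumes "2 \<le> i" and "i < 6"
  shows "initial xs i \<le> 1"
proof (cases "i < length xs")
  case True
  then have nth: "initial xs i = (matrix_H @ matrix_G @ map low [1..<n + 1] @ map up [1..<n + 1]) ! (i - 2)"
    using assms by (cases i; cases "i - 1") (simp_all add: initial_def encode_eq del: upt_Suc)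
  have H: "a \<le> 1" if "a \<in> set matrix_H" for a using that by (auto simp: matrix_H_def)
  have G: "a \<le> 1" if "a \<in> set matrix_G" for a using that by (auto simp: matrix_G_def)
  show ?thesis
  proof (cases "2 \<le> h")
    case h: True
    then have "i - 2 < h * h" using assms mult_le_mono[of 2 h 2 h] by simp
    then have "initial xs i = matrix_H ! (i - 2)" unfolding nth by (simp add: nth_append lengths)
    then show ?thesis using H nth_mem[of "i - 2" matrix_H] \<open>i - 2 < h * h\<close> lengths by metis
  next
    case h: False
    have "i - 2 < length (matrix_H @ matrix_G @ map low [1..<n + 1] @ map up [1..<n + 1])"
    proof -
      have "length (matrix_H @ matrix_G @ map low [1..<n + 1] @ map up [1..<n + 1]) = h * h + n * n + 2 * n"
        by (simp add: lengths del: upt_Suc)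
      then show ?thesis using True assms length_encode by linarith
    qed
    then have "initial xs i \<in> set (matrix_H @ matrix_G @ map low [1..<n + 1] @ map up [1..<n + 1])"
      unfolding nth by (rule nth_mem)
    then show ?thesis using H G ranges h by fastforce
  qed
qed (simp add: initial_def)

end

section \<open>The complete program and its running time\<close>

definition whole :: lcom where
  "whole = LSeq dispatch (LSeq (tr solver) (Block [LoadC 2 0, Add 0 (6 + vres) 2]))"

context hom_instance
begin

definition total_bound :: nat where
  "total_bound = relocate_bound h n + 3 + 3 + 3 + (hom_program.solver_bound h n EH + 2)"

lemma whole_correct:
  "\<exists>m'. exec whole (initial xs) m' total_bound \<and> m' 0 = (if hom_star_yes h EH n EG low up then 1 else 0)"
proof -
  interpret hom_program h n EH EG low up "length xs" "initial xs" by (rule encode_program)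
  have zero: "initial xs i = 0" if "length xs \<le> i" for i using that by (simp add: initial_def)
  obtain m1 s where 1: "exec dispatch (initial xs) m1 (relocate_bound h n + 3 + 3 + 3)"
    and s: "s vL = length xs"
    and r1: "rel (length xs + 64) (s, \<lambda>k. if k = 0 then initial xs else (\<lambda>i. 0)) m1"
    using dispatch_correct[OF inp_sizes initial_cell2 L zero initial_bit initial_bit initial_bit] by auto
  obtain \<sigma>' where \<sigma>': "exec2 solver (s, \<lambda>k. if k = 0 then initial xs else (\<lambda>i. 0)) \<sigma>' solver_bound"
      "fst \<sigma>' vres = (if hom_star_yes h EH n EG low up then 1 else 0)"
    using solver_correct[of s "\<lambda>k. if k = 0 then initial xs else (\<lambda>i. 0)"] s by auto
  obtain m2 where 2: "exec (tr solver) m1 m2 solver_bound" and r2: "rel (length xs + 64) \<sigma>' m2"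
    using \<sigma>'(1) r1 unfolding exec2_def by blast
  let ?b = "[LoadC 2 0, Add 0 (6 + vres) 2]"
  have 3: "exec (Block ?b) m2 (fold eff ?b m2) 2"
    by (rule exec_BlockI) simp_all
  have "exec whole (initial xs) (fold eff ?b m2) total_bound"
    unfolding whole_def total_bound_def by (rule exec_Seq[OF 1 exec_Seq[OF 2 3]])
  moreover have "\<forall>x<24. m2 (6 + x) = fst \<sigma>' x" using r2 by (simp add: rel_def)
  from this[rule_format, of vres] have "fold eff ?b m2 0 = fst \<sigma>' vres" by simp
  ultimately show ?thesis using \<sigma>'(2) by metis
qed

text \<open>The greedy count starts at 1 even for the empty graph, whence
  \<open>max 1 k\<close>.\<close>

lemma K_bounds:
  assumes "shifted_clique h EH k"
  shows "K \<le> max 1 k" and "k = 0 \<Longrightarrow> h = 0"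
proof -
  show "K \<le> max 1 k"
    using seg_le_shifted_clique[OF assms, of h] by (cases "h = 0") auto
  show "h = 0" if "k = 0" using assms that by (auto simp: shifted_clique_def)
qed

end

text \<open>A common bound for all polynomial round counts; the scan, with about
  \<open>n ^ 3 * h\<close> rounds, and the quadratic segmentation dictate the exponents.\<close>

definition scale :: "nat \<Rightarrow> nat \<Rightarrow> nat" where
  "scale h n = (n + 2) ^ 3 * (h + 2) ^ 2"

lemma scale_ge:
  "1 \<le> scale h n" "n + 2 \<le> scale h n" "h * (h + 2) + h + 2 \<le> scale h n" "h + 3 \<le> scale h n"
  "n * (h + 1) * ((n + 1) * (n + 1)) + (n * (n + 1) + n) + 2 \<le> scale h n"
  "2 + h * h + n * n + 2 * n + 1 \<le> scale h n"
  by (simp_all add: scale_def power2_eq_square power3_eq_cube algebra_simps)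

definition try_const :: nat where
  "try_const = cost (Asg vv (N 1)) + (loop_cost vertex_guard reset_body + (cost scan_init +
     (loop_cost vertex_guard (decide ;; apply_act) +
      (length (tre (V vfail) 30) +
        (cost (Asg vi (N 1)) + (loop_cost carry_guard carry_body +
          cost (Cond (V vi \<ominus> V vK) (Asg vgo (N 0)) (Wr aD (V vi) (Arr aD (V vi) \<oplus> N 1)))) +
         cost (Asg vres (N 1) ;; Asg vgo (N 0)) + 3)))))"

definition solver_const :: nat where
  "solver_const = cost segment_init + (loop_cost segment_guard segment_body +
     (cost search_init + 3 * (try_const + length (tre (V vgo) 30) + 3)))"

lemma scale_const: "c \<le> c * scale h n"
  using scale_ge(1)[of h n] by simp

lemma scale_mult: "a \<le> scale h n \<Longrightarrow> a * c \<le> c * scale h n"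
  by (simp add: mult.commute)

context hom_program
begin

lemma try_bound_le: "try_bound \<le> try_const * scale h n"
proof -
  \<comment> \<open>The linear factor \<open>K\<close> of the carry loop is charged to
    \<open>h\<close>, so it does not touch the exponent.\<close>
  have "K \<le> h + 1"
  proof -
    have "seg E x \<le> x + 1" for E x by (induction x) auto
    then show ?thesis .
  qed
  then have K: "K + 2 \<le> scale h n" using scale_ge(4)[of h n] by linarith
  have scan: "scan_bound + 2 \<le> scale h n" unfolding scan_bound_def by (rule scale_ge(5))
  show ?thesis
    unfolding try_bound_def try_const_def add_mult_distrib[of _ _ "scale h n"]
    by (intro add_mono scale_const scale_mult scale_ge(2) scan K)
qed

lemma solver_bound_le: "solver_bound \<le> solver_const * ((n + 2) ^ K * scale h n)"
proof -
  let ?P = "(n + 2) ^ K" and ?t = "length (tre (V vgo) 30)"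
  have P: "1 \<le> ?P" by simp
  have grow: "a \<le> c * (?P * scale h n)" if "a \<le> c * scale h n" for a c
  proof -
    have "scale h n \<le> ?P * scale h n" by simp
    then show ?thesis using order_trans[OF that mult_le_mono2] by blast
  qed
  have "(n + 1) ^ K \<le> ?P" by (rule power_mono) simp_all
  then have "(n + 1) ^ K + 2 \<le> 3 * ?P" using P by linarith
  moreover have "try_bound + ?t + 3 \<le> (try_const + ?t + 3) * scale h n"
    unfolding add_mult_distrib[of _ _ "scale h n"] by (intro add_mono try_bound_le scale_const)
  ultimately have "((n + 1) ^ K + 2) * (try_bound + ?t + 3) \<le> (3 * ?P) * ((try_const + ?t + 3) * scale h n)"
    by (rule mult_le_mono)
  also have "\<dots> = 3 * (try_const + ?t + 3) * (?P * scale h n)" by (simp only: ac_simps)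
  finally have rounds: "((n + 1) ^ K + 2) * (try_bound + ?t + 3) \<le> 3 * (try_const + ?t + 3) * (?P * scale h n)" .
  show ?thesis
    unfolding solver_bound_def solver_const_def add_mult_distrib[of _ _ "?P * scale h n"]
    by (rule add_mono rounds grow scale_const scale_mult scale_ge(3))+
qed

end

lemma relocate_bound_le: "relocate_bound h n \<le> 50 * scale h n"
proof -
  have "relocate_bound h n \<le> 30 + 5 * (h + 3) + 5 * (n + 2) + 9 * (2 + h * h + n * n + 2 * n + 1)"
    by (simp add: relocate_bound_def)
  also have "\<dots> \<le> 30 * scale h n + 5 * scale h n + 5 * scale h n + 9 * scale h n"
    by (intro add_mono mult_le_mono2 scale_const scale_ge)
  finally show ?thesis by simp
qed

context hom_instance
begin

lemma total_bound_le:
  assumes "shifted_clique h EH k" and "c \<ge> solver_const + 61"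
  shows "total_bound \<le> c * (n + 2) ^ (c * k) * (h + 2) ^ c"
proof -
  interpret hom_program h n EH EG low up "length xs" "initial xs" by (rule encode_program)
  let ?Q = "(n + 2) ^ K * scale h n"
  have le: "scale h n \<le> ?Q" by simp
  \<comment> \<open>The 11 collects three nested tests of 3 steps each and the 2 instructions that
    output the result; with the 50 for relocation this gives 61.\<close>
  have "total_bound \<le> 50 * scale h n + (11 * scale h n + solver_const * ?Q)"
    using relocate_bound_le[of h n] solver_bound_le scale_ge(1)[of h n]
    unfolding total_bound_def by linarith
  also have "\<dots> \<le> 50 * ?Q + (11 * ?Q + solver_const * ?Q)"
    by (intro add_mono mult_le_mono2 le order_refl)
  also have "\<dots> = (solver_const + 61) * ?Q" by (simp add: algebra_simps)
  also have "\<dots> \<le> c * ?Q" using assms(2) by (rule mult_le_mono1)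
  also have "?Q \<le> (n + 2) ^ (c * k) * (h + 2) ^ c"
  \<comment> \<open>For \<open>k = 0\<close> the factor with exponent \<open>c * k\<close> is 1;
    then both graphs are empty and the constant \<open>2 ^ 6\<close> is absorbed by
    \<open>2 ^ c\<close>.\<close>
  proof (cases "k = 0")
    case True
    then have 0: "h = 0" "n = 0" using K_bounds(2)[OF assms(1)] h_zero by auto
    then have two: "h + 2 = 2" "n + 2 = 2" by simp_all
    have "?Q = 2 ^ 6" unfolding scale_def two using 0 by simp
    also have "\<dots> \<le> 2 ^ c" using assms(2) by (intro power_increasing) auto
    finally show ?thesis unfolding two True by simp
  next
    case False
    \<comment> \<open>From \<open>K \<le> k\<close> and \<open>1 \<le> k\<close>; this puts the
      fixed exponent 3 of \<open>scale\<close> into the multiple of \<open>k\<close>.\<close>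
    then have "K + 3 \<le> 4 * k" using K_bounds(1)[OF assms(1)] by simp
    also have "\<dots> \<le> c * k" using assms(2) by (intro mult_le_mono1) simp
    finally have "(n + 2) ^ (K + 3) \<le> (n + 2) ^ (c * k)" by (intro power_increasing) auto
    moreover have "(h + 2) ^ 2 \<le> (h + 2) ^ c" using assms(2) by (intro power_increasing) auto
    ultimately have "(n + 2) ^ (K + 3) * (h + 2) ^ 2 \<le> (n + 2) ^ (c * k) * (h + 2) ^ c"
      by (rule mult_le_mono)
    then show ?thesis by (simp only: scale_def power_add mult.assoc)
  qed
  finally show ?thesis by (simp only: mult.assoc) simp
qed

end

theorem theorem3:
  "\<exists>(P :: instr list) (c :: nat).
     \<forall>h EH n EG low up k.
       ordered_graph h EH \<longrightarrow> ordered_graph n EG \<longrightarrow>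
       (\<forall>v\<in>{1..n}. low v \<in> {1..h} \<and> up v \<in> {1..h}) \<longrightarrow>
       shifted_clique h EH k \<longrightarrow>
       (\<exists>t. t \<le> c * (n + 2) ^ (c * k) * (h + 2) ^ c \<and>
            halted P (run P t (init (encode h EH n EG low up))) \<and>
            snd (run P t (init (encode h EH n EG low up))) 0 =
              (if hom_star_yes h EH n EG low up then 1 else 0))"
proof (rule exI[of _ "comp 0 whole"], rule exI[of _ "solver_const + 61"], intro allI impI)
  fix h EH n EG low up k
  assume H: "ordered_graph h EH" and G: "ordered_graph n EG"
    and ranges: "\<forall>v\<in>{1..n}. low v \<in> {1..h} \<and> up v \<in> {1..h}" and clique: "shifted_clique h EH k"
  interpret hom_instance h n EH EG low up
    by unfold_locales (use H G ranges in auto)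
  let ?xs = "encode h EH n EG low up"
  let ?c = "solver_const + 61"
  obtain m' where m': "exec whole (initial ?xs) m' total_bound"
      "m' 0 = (if hom_star_yes h EH n EG low up then 1 else 0)"
    using whole_correct by blast
  \<comment> \<open>The run ends one position past the last instruction, which counts as
    \<open>halted\<close>.\<close>
  obtain t where t: "t \<le> total_bound" "run (comp 0 whole) t (0, initial ?xs) = (clen whole, m')"
    using execD[OF m'(1), of "comp 0 whole" "[]" 0 "[]"] by auto
  have init: "init ?xs = (0, initial ?xs)" by (simp add: init_def initial_def)
  have "t \<le> ?c * (n + 2) ^ (?c * k) * (h + 2) ^ ?c"
    using t(1) total_bound_le[OF clique order_refl] by (rule order_trans)
  then show "\<exists>t. t \<le> ?c * (n + 2) ^ (?c * k) * (h + 2) ^ ?c \<and>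
      halted (comp 0 whole) (run (comp 0 whole) t (init ?xs)) \<and>
      snd (run (comp 0 whole) t (init ?xs)) 0 = (if hom_star_yes h EH n EG low up then 1 else 0)"
    using t(2) m'(2) by (intro exI[of _ t]) (simp add: init halted_def)
qed

end
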